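(* Let $\hat\sigma^2=\frac1d\|Y-\hat\theta\|_2^2$ with $\hat\theta$ the sorted-$\ell_1$ estimator. (1) Let $\tau>0,a>0$. There exist constants $c,C>0$ and $\gamma\in(0,1/2]$ depending only on $(a,\tau)$ such that for all integers $s,d$ with $1\le s<\lfloor\gamma d\rfloor/4$, with $\lambda_j=c\log^{1/a}(ed/j)$ and $\tilde\sigma$ built with this $\gamma$, $$\sup_{P_\xi\in\mathcal G_{a,\tau}}\sup_{\sigma>0}\sup_{\theta\in\Theta_s}\mathbf E_{\theta,P_\xi,\sigma}|\hat\sigma^2-\sigma^2|\le C\sigma^2\max\Big(\frac1{\sqrt d},\frac sd\log^{2/a}\Big(\frac{ed}s\Big)\Big).$$ (2) Let $\tau>0,a>4$. There exist constants $c,C>0$ and $\gamma\in(0,1/2]$ depending only on $(a,\tau)$ such that for all integers $s,d$ with $1\le s<\lfloor\gamma d\rfloor/4$, with $\lambda_j=c(d/j)^{1/a}$ and $\tilde\sigma$ built with this $\gamma$, $$\sup_{P_\xi\in\mathcal P_{a,\tau}}\sup_{\sigma>0}\sup_{\theta\in\Theta_s}\mathbf E_{\theta,P_\xi,\sigma}|\hat\sigma^2-\sigma^2|\le C\sigma^2\max\Big(\frac1{\sqrt d},\Big(\frac sd\Big)^{1-\frac2a}\Big).$$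
   Context: Model: $Y_i=\theta_i+\sigma\xi_i$, $i=1,\dots,d$, $\theta\in\mathbb R^d$, $\sigma>0$, $\xi_i$ i.i.d. with distribution $P_\xi$, $\mathbf E\xi_1=0,\mathbf E\xi_1^2=1$; $\mathbf E_{\theta,P_\xi,\sigma}$ expectation; $\Theta_s=\{\theta:\|\theta\|_0\le s\}$. $\mathcal G_{a,\tau}$ ($a,\tau>0$): distributions with $\mathbf E\xi_1=0,\mathbf E\xi_1^2=1$, $\mathbf P(|\xi_1|>t)\le2e^{-(t/\tau)^a}$ for all $t\ge2$; $\mathcal P_{a,\tau}$ ($\tau>0,a\ge2$): such distributions with $\mathbf P(|\xi_1|>t)\le(\tau/t)^a$ for all $t\ge2$. Median-of-means: given $\gamma\in(0,1/2]$, $m=\lfloor\gamma d\rfloor$, disjoint blocks $B_1,\dots,B_m$ partitioning $\{1,\dots,d\}$ each of size $\ge\lfloor d/m\rfloor$, $\bar\sigma_i^2=|B_i|^{-1}\sum_{j\in B_i}Y_j^2$, $\tilde\sigma^2=\mathrm{med}(\bar\sigma_i^2)$, $\tilde\sigma=\sqrt{\tilde\sigma^2}$. Sorted-$\ell_1$ estimator: for $\lambda_1\ge\dots\ge\lambda_d>0$, $\|\theta\|_*=\sum_i\lambda_i|\theta|_{(d-i+1)}$ ($|\theta|_{(1)}\le\dots\le|\theta|_{(d)}$ order statistics of $|\theta_i|$), $\hat\theta\in\arg\min_\theta\big(\sum_i(Y_i-\theta_i)^2+\tilde\sigma\|\theta\|_*\big)$. *)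

theory Defs
  imports "HOL-Probability.Probability"
begin

text \<open>Vectors in R^d are functions nat => real; only the coordinates 0..d-1 matter.
  Weights lam are indexed 1..d as in the paper (lam 1 >= ... >= lam d).\<close>

definition sorted_l1 :: "(nat \<Rightarrow> real) \<Rightarrow> nat \<Rightarrow> (nat \<Rightarrow> real) \<Rightarrow> real" where
  "sorted_l1 lam d \<theta> =
     (let desc = rev (sort (map (\<lambda>j. \<bar>\<theta> j\<bar>) [0..<d])) in
      (\<Sum>i<d. lam (Suc i) * desc ! i))"

definition median :: "real list \<Rightarrow> real" where
  "median xs = (let ys = sort xs; n = length ys in
     if odd n then ys ! (n div 2) else (ys ! (n div 2 - 1) + ys ! (n div 2)) / 2)"

definition mom_blocks :: "nat \<Rightarrow> nat \<Rightarrow> (nat \<Rightarrow> nat set) \<Rightarrow> bool" where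
  "mom_blocks d m B \<longleftrightarrow>
     (\<forall>i<m. B i \<subseteq> {..<d} \<and> card (B i) \<ge> d div m) \<and>
     (\<forall>i<m. \<forall>j<m. i \<noteq> j \<longrightarrow> B i \<inter> B j = {}) \<and>
     (\<Union>i<m. B i) = {..<d}"

definition mom_sigma :: "nat \<Rightarrow> (nat \<Rightarrow> nat set) \<Rightarrow> (nat \<Rightarrow> real) \<Rightarrow> real" where
  "mom_sigma m B Y =
     sqrt (median (map (\<lambda>i. (\<Sum>j\<in>B i. (Y j)\<^sup>2) / real (card (B i))) [0..<m]))"

definition slope_obj ::
  "(nat \<Rightarrow> real) \<Rightarrow> nat \<Rightarrow> real \<Rightarrow> (nat \<Rightarrow> real) \<Rightarrow> (nat \<Rightarrow> real) \<Rightarrow> real" where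
  "slope_obj lam d st Y \<theta> = (\<Sum>i<d. (Y i - \<theta> i)\<^sup>2) + st * sorted_l1 lam d \<theta>"

definition slope_est ::
  "(nat \<Rightarrow> real) \<Rightarrow> nat \<Rightarrow> real \<Rightarrow> (nat \<Rightarrow> real) \<Rightarrow> (nat \<Rightarrow> real)" where
  "slope_est lam d st Y = (SOME \<theta>. (\<forall>j\<ge>d. \<theta> j = 0) \<and>
      (\<forall>\<theta>'. (\<forall>j\<ge>d. \<theta>' j = 0) \<longrightarrow> slope_obj lam d st Y \<theta> \<le> slope_obj lam d st Y \<theta>'))"

definition sigma_hat2 ::
  "(nat \<Rightarrow> real) \<Rightarrow> nat \<Rightarrow> nat \<Rightarrow> (nat \<Rightarrow> nat set) \<Rightarrow> (nat \<Rightarrow> real) \<Rightarrow> real" where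
  "sigma_hat2 lam d m B Y =
     (let th = slope_est lam d (mom_sigma m B Y) Y in (\<Sum>i<d. (Y i - th i)\<^sup>2) / real d)"

definition std_noise :: "real measure \<Rightarrow> bool" where
  "std_noise P \<longleftrightarrow> prob_space P \<and> sets P = sets borel \<and>
     integrable P (\<lambda>x. x) \<and> integrable P (\<lambda>x. x\<^sup>2) \<and>
     (\<integral>x. x \<partial>P) = 0 \<and> (\<integral>x. x\<^sup>2 \<partial>P) = 1"

definition class_G :: "real \<Rightarrow> real \<Rightarrow> real measure \<Rightarrow> bool" where
  "class_G a \<tau> P \<longleftrightarrow> std_noise P \<and>
     (\<forall>t\<ge>2. measure P {x. \<bar>x\<bar> > t} \<le> 2 * exp (- ((t / \<tau>) powr a)))"

definition class_P :: "real \<Rightarrow> real \<Rightarrow> real measure \<Rightarrow> bool" where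
  "class_P a \<tau> P \<longleftrightarrow> std_noise P \<and>
     (\<forall>t\<ge>2. measure P {x. \<bar>x\<bar> > t} \<le> (\<tau> / t) powr a)"

text \<open>E_{theta,P,sigma} f(Y) with Y_i = theta_i + sigma xi_i, xi_i iid ~ P
  (nonnegative integral, so no integrability side condition).\<close>
definition expect_Y ::
  "nat \<Rightarrow> real measure \<Rightarrow> real \<Rightarrow> (nat \<Rightarrow> real) \<Rightarrow> ((nat \<Rightarrow> real) \<Rightarrow> real) \<Rightarrow> ennreal" where
  "expect_Y d P \<sigma> \<theta> f =
     (\<integral>\<^sup>+ \<xi>. ennreal (f (\<lambda>i. \<theta> i + \<sigma> * \<xi> i)) \<partial>(PiM {..<d} (\<lambda>_. P)))"

end

theory Submission
  imports Defs
begin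

text \<open>
  Write \<open>u\<close> for the estimation error. Comparing the objective at the estimator and at \<open>\<theta>\<close>
  gives \<open>|u|^2 \<le> 2 \<sigma> <\<xi>, u> + st * (|\<theta>|_* - |\<theta> + u|_*)\<close>, where \<open>st\<close> is the median-of-means
  scale. List the support of \<open>\<theta>\<close> first and the other coordinates by decreasing noise: the
  rearrangement inequality bounds the norm difference along this list, and as soon as
  \<open>st \<ge> \<sigma> / 2\<close> the penalty absorbs all noise order statistics below their typical size
  \<open>K \<mu>\<^sub>j\<close>. The excess of the \<open>j\<close>-th order statistic over \<open>3 x\<close> is at most of order \<open>1 / j\<close> times
  the deviation of \<open>\<Sum>i. (|\<xi>\<^sub>i| - x)\<^sub>+\<close> from its mean, so Chebyshev-type second moments suffice. Fewer
  than a quarter of the blocks meet the support; hence \<open>st^2\<close> is at most \<open>4 / m\<close> times the sum over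
  clean blocks, while \<open>st < \<sigma> / 2\<close> forces a large deviation of an average of bounded independent
  block statistics, an event of probability \<open>O(1 / m)\<close> on which the crude bound
  \<open>|u|^2 = O(\<sigma>^2 |\<xi>|^2 + st^2 \<Sum>j\<le>2s. \<lambda>\<^sub>j^2)\<close> is enough.
\<close>

section \<open>The sorted l1 norm and its minimisers\<close>

text \<open>The split on the size of the scale never enters an expectation as an indicator. On the
  bad event the energy \<open>|\<xi>|^2 / d\<close> is at most 1 plus its deviation, and the 1 is
  dominated by a normalised squared deviation that is at least 1 there. So no product of an
  indicator with the energy has to be estimated: there is one pointwise bound, affine in quantities
  whose means are known. It asks for a fourth moment of the noise, whence \<open>a > 4\<close> for
  polynomial tails.

  The residual error contains the cross term with the noise in absolute value, whereas comparing
  objectives controls it from one side only. The weights are therefore twice what absorption alone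
  would require. In \<open>24 = 4 * 3 * 2\<close> the 2 stands for
  \<open>st \<ge> \<sigma> / 2\<close>, the 3 for truncation of the noise at \<open>3 * x\<close>,
  and the 4 for twice the coefficient 2 of the cross term.

  The fraction \<open>\<gamma> = 1 / n0\<close> gives every block at least \<open>n0\<close> points;
  \<open>n0\<close> is large compared with the fourth moment, so that a clean block has mean
  deficiency at most \<open>1 / 16\<close>.\<close>

lemma sum_mult_insort_key:
  fixes lam :: "nat \<Rightarrow> real"
  assumes "\<And>i j. i \<le> j \<Longrightarrow> j \<le> length ys \<Longrightarrow> lam j \<le> lam i"
  shows "(\<Sum>i<length (x # ys). lam i * (x # ys) ! i)
         \<le> (\<Sum>i<length (x # ys). lam i * insort_key uminus x ys ! i)"
  using assms
proof (induction ys arbitrary: lam)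
  case Nil
  then show ?case by simp
next
  case (Cons y ys)
  show ?case
  proof (cases "y \<le> x")
    case True
    then show ?thesis by simp
  next
    case False
    \<comment> \<open>Exchange of the first two entries: the larger one moves to the larger weight.
      The rest of the insertion is the induction hypothesis for shifted weights.\<close>
    have "lam 0 * x + lam 1 * y \<le> lam 0 * y + lam 1 * x"
      using mult_right_mono[of "lam 1" "lam 0" "y - x"] Cons.prems[of 0 1] False
      by (simp add: algebra_simps)
    moreover have "(\<Sum>i<length (x # ys). lam (Suc i) * (x # ys) ! i)
         \<le> (\<Sum>i<length (x # ys). lam (Suc i) * insort_key uminus x ys ! i)"
      using Cons.prems by (intro Cons.IH) auto
    ultimately show ?thesis
      using False by (simp add: sum.lessThan_Suc_shift del: sum.lessThan_Suc)
  qed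
qed

text \<open>Rearrangement inequality in the form of insertion sort: every insertion is a chain of
  exchanges that do not decrease the weighted sum. The key \<open>uminus\<close> makes the sorting
  decreasing.\<close>

lemma sum_mult_le_sorted:
  fixes lam :: "nat \<Rightarrow> real"
  assumes "\<And>i j. i \<le> j \<Longrightarrow> j < length xs \<Longrightarrow> lam j \<le> lam i"
  shows "(\<Sum>i<length xs. lam i * xs ! i)
         \<le> (\<Sum>i<length xs. lam i * sort_key uminus xs ! i)"
  using assms
proof (induction xs arbitrary: lam)
  case Nil
  then show ?case by simp
next
  case (Cons x xs)
  have "(\<Sum>i<length xs. lam (Suc i) * xs ! i)
         \<le> (\<Sum>i<length xs. lam (Suc i) * sort_key uminus xs ! i)"
    using Cons.prems by (intro Cons.IH) auto
  then have "(\<Sum>i<length (x # xs). lam i * (x # xs) ! i)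
    \<le> (\<Sum>i<length (x # xs). lam i * (x # sort_key uminus xs) ! i)"
    by (simp add: sum.lessThan_Suc_shift del: sum.lessThan_Suc)
  also have "\<dots> \<le> (\<Sum>i<length (x # xs). lam i * sort_key uminus (x # xs) ! i)"
    using sum_mult_insort_key[of "sort_key uminus xs" lam x] Cons.prems by simp
  finally show ?case .
qed

lemma rev_sort_eqI:
  fixes xs ys :: "real list"
  assumes "mset xs = mset ys" "sorted_wrt (\<ge>) ys"
  shows "rev (sort xs) = ys"
proof -
  have "sort xs = rev ys"
    using assms by (intro properties_for_sort) (simp_all add: sorted_wrt_rev)
  then show ?thesis by simp
qed

lemma rev_sort_eq_sort_key:
  fixes xs :: "real list"
  shows "rev (sort xs) = sort_key uminus xs"
proof (rule rev_sort_eqI)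
  have "sorted_wrt (\<lambda>x y. - x \<le> - y) (sort_key uminus xs)"
    using sorted_sort_key[of uminus xs] by (simp add: sorted_wrt_map)
  then show "sorted_wrt (\<ge>) (sort_key uminus xs)"
    by (simp add: sorted_wrt_iff_nth_less)
qed simp

text \<open>Lets an ordering chosen from the true parameter and the noise bound the norm of the
  estimator from below, although the estimator has a different sorting order.\<close>

lemma sorted_l1_ge:
  assumes "\<And>i j. 1 \<le> i \<Longrightarrow> i \<le> j \<Longrightarrow> j \<le> d \<Longrightarrow> lam j \<le> lam i" "mset L = mset [0..<d]"
  shows "(\<Sum>r<d. lam (Suc r) * \<bar>\<theta> (L ! r)\<bar>) \<le> sorted_l1 lam d \<theta>"
proof -
  have len: "length L = d"
    using mset_eq_length[OF assms(2)] by simp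
  have "(\<Sum>r<d. lam (Suc r) * map (\<lambda>j. \<bar>\<theta> j\<bar>) L ! r)
      \<le> (\<Sum>r<d. lam (Suc r) * sort_key uminus (map (\<lambda>j. \<bar>\<theta> j\<bar>) L) ! r)"
    using sum_mult_le_sorted[of "map (\<lambda>j. \<bar>\<theta> j\<bar>) L" "\<lambda>r. lam (Suc r)"] assms(1) len by simp
  moreover have "rev (sort (map (\<lambda>j. \<bar>\<theta> j\<bar>) [0..<d])) = sort_key uminus (map (\<lambda>j. \<bar>\<theta> j\<bar>) L)"
    unfolding rev_sort_eq_sort_key[symmetric]
    by (intro arg_cong[of _ _ rev] properties_for_sort) (simp_all add: assms(2))
  ultimately show ?thesis
    by (simp add: sorted_l1_def Let_def len)
qed

lemma sorted_l1_eq: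
  assumes "mset L = mset [0..<d]" "sorted_wrt (\<ge>) (map (\<lambda>j. \<bar>\<theta> j\<bar>) L)"
  shows "sorted_l1 lam d \<theta> = (\<Sum>r<d. lam (Suc r) * \<bar>\<theta> (L ! r)\<bar>)"
proof -
  have len: "length L = d"
    using mset_eq_length[OF assms(1)] by simp
  have "rev (sort (map (\<lambda>j. \<bar>\<theta> j\<bar>) [0..<d])) = map (\<lambda>j. \<bar>\<theta> j\<bar>) L"
    using assms by (intro rev_sort_eqI) (metis mset_map)
  then show ?thesis
    by (simp add: sorted_l1_def Let_def len)
qed

lemma sorted_l1_nonneg:
  assumes "\<And>j. 1 \<le> j \<Longrightarrow> j \<le> d \<Longrightarrow> lam j \<ge> 0"
  shows "sorted_l1 lam d \<theta> \<ge> 0"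
proof -
  define desc where "desc = rev (sort (map (\<lambda>j. \<bar>\<theta> j\<bar>) [0..<d]))"
  have "desc ! i \<ge> 0" if "i < d" for i
  proof -
    have "desc ! i \<in> set desc"
      using that by (intro nth_mem) (simp add: desc_def)
    then show ?thesis
      by (auto simp: desc_def)
  qed
  then show ?thesis
    using assms by (auto simp: sorted_l1_def Let_def desc_def[symmetric] intro!: sum_nonneg mult_nonneg_nonneg)
qed

lemma sorted_l1_zero: "sorted_l1 lam d (\<lambda>_. 0) = 0"
  using sorted_l1_eq[of "[0..<d]" d "\<lambda>_. 0" lam] by (simp add: sorted_wrt_iff_nth_less)

text \<open>Serves continuity, which is hard to see through \<open>sort\<close> but clear for a
  maximum of finitely many continuous functions.\<close>

lemma sorted_l1_eq_Max:
  assumes "\<And>i j. 1 \<le> i \<Longrightarrow> i \<le> j \<Longrightarrow> j \<le> d \<Longrightarrow> lam j \<le> lam i"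
  shows "sorted_l1 lam d \<theta> =
    Max ((\<lambda>L. \<Sum>r<d. lam (Suc r) * \<bar>\<theta> (L ! r)\<bar>) ` {L. mset L = mset [0..<d]})"
proof (rule sym, rule Max_eqI)
  show "finite ((\<lambda>L. \<Sum>r<d. lam (Suc r) * \<bar>\<theta> (L ! r)\<bar>) ` {L. mset L = mset [0..<d]})"
    by (intro finite_imageI) (rule mset_eq_finite)
  define L where "L = sort_key (\<lambda>j. - \<bar>\<theta> j\<bar>) [0..<d]"
  have "sorted (map (\<lambda>j. - \<bar>\<theta> j\<bar>) L)"
    unfolding L_def by (rule sorted_sort_key)
  then have "sorted_wrt (\<ge>) (map (\<lambda>j. \<bar>\<theta> j\<bar>) L)"
    by (simp add: sorted_wrt_iff_nth_less)
  then have "sorted_l1 lam d \<theta> = (\<Sum>r<d. lam (Suc r) * \<bar>\<theta> (L ! r)\<bar>)"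
    by (intro sorted_l1_eq) (simp_all add: L_def)
  then show "sorted_l1 lam d \<theta> \<in> (\<lambda>L. \<Sum>r<d. lam (Suc r) * \<bar>\<theta> (L ! r)\<bar>) ` {L. mset L = mset [0..<d]}"
    by (intro image_eqI[of _ _ L]) (simp_all add: L_def)
qed (use sorted_l1_ge[OF assms] in auto)

lemma continuous_on_Max_image:
  fixes f :: "'i \<Rightarrow> 'a::topological_space \<Rightarrow> real"
  assumes "finite I" "I \<noteq> {}" "\<And>i. i \<in> I \<Longrightarrow> continuous_on A (f i)"
  shows "continuous_on A (\<lambda>x. Max ((\<lambda>i. f i x) ` I))"
  using assms
  by (induction I rule: finite_ne_induct) (auto intro!: continuous_on_max)

lemma continuous_on_sorted_l1:
  assumes "\<And>i j. 1 \<le> i \<Longrightarrow> i \<le> j \<Longrightarrow> j \<le> d \<Longrightarrow> lam j \<le> lam i"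
  shows "continuous_on A (sorted_l1 lam d)"
proof -
  have fin: "finite {L. mset L = mset [0..<d]}" "{L. mset L = mset [0..<d]} \<noteq> {}"
    by (rule mset_eq_finite) blast
  have "continuous_on A (\<lambda>\<theta>. Max ((\<lambda>L. \<Sum>r<d. lam (Suc r) * \<bar>\<theta> (L ! r)\<bar>) ` {L. mset L = mset [0..<d]}))"
    using fin
  proof (rule continuous_on_Max_image)
    fix L :: "nat list"
    have "continuous_on A (\<lambda>\<theta>. \<theta> (L ! r) :: real)" for r
      by (rule continuous_on_subset[OF continuous_on_product_coordinates]) simp
    then show "continuous_on A (\<lambda>\<theta>. \<Sum>r<d. lam (Suc r) * \<bar>\<theta> (L ! r)\<bar>)"
      by (intro continuous_on_sum continuous_on_mult continuous_on_const continuous_on_rabs)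
  qed
  then show ?thesis
    by (subst continuous_on_cong[OF refl sorted_l1_eq_Max[OF assms]])
qed

text \<open>\<open>slope_est\<close> is a \<open>SOME\<close> choice, so its defining property is
  available only once a minimiser exists. Existence comes from compactness of a box in the product
  topology, with sides of length zero from coordinate \<open>d\<close> on to encode the support
  condition.\<close>

lemma slope_est_minimises:
  assumes anti: "\<And>i j. 1 \<le> i \<Longrightarrow> i \<le> j \<Longrightarrow> j \<le> d \<Longrightarrow> lam j \<le> lam i"
    and pos: "\<And>j. 1 \<le> j \<Longrightarrow> j \<le> d \<Longrightarrow> lam j \<ge> 0" and st: "st \<ge> 0"
    and \<theta>: "\<And>j. j \<ge> d \<Longrightarrow> \<theta> j = 0"
  shows "slope_obj lam d st Y (slope_est lam d st Y) \<le> slope_obj lam d st Y \<theta>"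
proof -
  \<comment> \<open>A point that leaves the box at coordinate \<open>j\<close> has
    \<open>(Y j - \<theta>' j)^2 \<ge> R^2 \<ge> R\<close>, which exceeds the objective at zero. The
    summand 1 ensures \<open>R^2 \<ge> R\<close>.\<close>
  define R where "R = 1 + (\<Sum>i<d. (Y i)\<^sup>2)"
  define b where "b = (\<lambda>j. if j < d then \<bar>Y j\<bar> + R else 0)"
  define S where "S = PiE UNIV (\<lambda>j. {- b j..b j})"
  have R1: "R \<ge> 1"
    by (simp add: R_def sum_nonneg)
  have comp: "compact S"
    using compactin_PiE[of "\<lambda>_::nat. euclideanreal" UNIV "\<lambda>j. {- b j..b j}"]
    by (simp add: euclidean_product_topology S_def)
  have z: "(\<lambda>_. 0) \<in> S"
    using R1 by (auto simp: S_def b_def)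
  have "continuous_on S (slope_obj lam d st Y)"
    unfolding slope_obj_def
    by (intro continuous_intros continuous_on_subset[OF continuous_on_product_coordinates] subset_UNIV
        continuous_on_sorted_l1[OF anti])
  then obtain \<theta>0 where \<theta>0: "\<theta>0 \<in> S" "\<And>\<theta>'. \<theta>' \<in> S \<Longrightarrow> slope_obj lam d st Y \<theta>0 \<le> slope_obj lam d st Y \<theta>'"
    using continuous_attains_inf[OF comp] z by (metis empty_iff)
  have supp: "\<theta>0 j = 0" if "j \<ge> d" for j
    using \<theta>0(1) that by (auto simp: S_def b_def PiE_iff split: if_splits dest!: spec[of _ j])
  have glob: "slope_obj lam d st Y \<theta>0 \<le> slope_obj lam d st Y \<theta>'" if \<theta>': "\<forall>j\<ge>d. \<theta>' j = 0" for \<theta>'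
  proof (cases "\<theta>' \<in> S")
    case True
    then show ?thesis by (rule \<theta>0(2))
  next
    case False
    then obtain j where j: "\<not> (- b j \<le> \<theta>' j \<and> \<theta>' j \<le> b j)"
      by (auto simp: S_def PiE_iff)
    then have jd: "j < d"
      using \<theta>' by (cases "j < d") (auto simp: b_def)
    have "\<bar>Y j - \<theta>' j\<bar> \<ge> R"
      using j jd by (auto simp: b_def)
    then have "(Y j - \<theta>' j)\<^sup>2 \<ge> R\<^sup>2"
      using R1 by (metis abs_le_square_iff abs_of_nonneg order_trans zero_le_one)
    moreover have "R\<^sup>2 \<ge> R"
      using R1 by (simp add: power2_eq_square)
    moreover have "(Y j - \<theta>' j)\<^sup>2 \<le> (\<Sum>i<d. (Y i - \<theta>' i)\<^sup>2)"
      using jd by (intro member_le_sum) auto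
    ultimately have "(\<Sum>i<d. (Y i)\<^sup>2) \<le> (\<Sum>i<d. (Y i - \<theta>' i)\<^sup>2)"
      by (simp add: R_def)
    moreover have "st * sorted_l1 lam d \<theta>' \<ge> 0"
      using st sorted_l1_nonneg[OF pos] by simp
    ultimately have "slope_obj lam d st Y (\<lambda>_. 0) \<le> slope_obj lam d st Y \<theta>'"
      by (simp add: slope_obj_def sorted_l1_zero)
    then show ?thesis
      using \<theta>0(2)[OF z] by linarith
  qed
  have "(\<forall>j\<ge>d. slope_est lam d st Y j = 0) \<and>
      (\<forall>\<theta>'. (\<forall>j\<ge>d. \<theta>' j = 0) \<longrightarrow> slope_obj lam d st Y (slope_est lam d st Y) \<le> slope_obj lam d st Y \<theta>')"
    unfolding slope_est_def
    by (rule someI[of _ \<theta>0]) (use supp glob in auto)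
  then show ?thesis using \<theta> by auto
qed

section \<open>Counting property of the median\<close>

lemma median_card:
  fixes f :: "nat \<Rightarrow> real"
  assumes "m > 0"
  defines "M \<equiv> median (map f [0..<m])"
  shows "m \<le> 2 * card {i\<in>{..<m}. f i \<ge> M}" "m \<le> 2 * card {i\<in>{..<m}. f i \<le> M}"
proof -
  define ys where "ys = sort (map f [0..<m])"
  have len: "length ys = m" and srt: "sorted ys"
    by (simp_all add: ys_def)
  have M: "M = (if odd m then ys ! (m div 2) else (ys ! (m div 2 - 1) + ys ! (m div 2)) / 2)"
    by (simp add: M_def median_def Let_def ys_def)
  have cnt: "card {i\<in>{..<m}. Q (f i)} = card {i\<in>{..<m}. Q (ys ! i)}" for Q
  proof -
    have "card {i\<in>{..<m}. Q (f i)} = length (filter Q (map f [0..<m]))"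
      unfolding length_filter_conv_card by (rule arg_cong[of _ _ card]) auto
    also have "\<dots> = length (filter Q ys)"
      unfolding ys_def by (metis mset_filter mset_sort size_mset)
    also have "\<dots> = card {i\<in>{..<m}. Q (ys ! i)}"
      unfolding length_filter_conv_card len by (rule arg_cong[of _ _ card]) auto
    finally show ?thesis .
  qed
  have mono: "ys ! i \<le> ys ! j" if "i \<le> j" "j < m" for i j
    using sorted_nth_mono[OF srt] that len by simp
  \<comment> \<open>For even \<open>m\<close> the median is the average of the two middle entries
    and lies between them, so both counts still reach half of \<open>m\<close>.\<close>
  have mid: "ys ! (m div 2 - 1) \<le> ys ! (m div 2)"
    using assms(1) by (intro mono) auto
  have up: "M \<le> ys ! i" if "m div 2 \<le> i" "i < m" for i
    using mono[OF that] mid unfolding M by (auto simp: field_simps)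
  have lo: "ys ! i \<le> M" if "i < m - m div 2" for i
  proof (cases "odd m")
    case True
    then have "i \<le> m div 2" using that by presburger
    then show ?thesis using mono[of i "m div 2"] True assms(1) by (simp add: M)
  next
    case False
    then have "i \<le> m div 2 - 1" using that by presburger
    moreover have "m div 2 - 1 < m" using assms(1) by simp
    ultimately show ?thesis using mono[of i "m div 2 - 1"] mid False
      by (simp add: M field_simps)
  qed
  have "card {m div 2..<m} \<le> card {i\<in>{..<m}. ys ! i \<ge> M}"
    using up by (intro card_mono) auto
  then show "m \<le> 2 * card {i\<in>{..<m}. f i \<ge> M}"
    using cnt[of "\<lambda>y. y \<ge> M"] by simp
  have "card {..<m - m div 2} \<le> card {i\<in>{..<m}. ys ! i \<le> M}"
    using lo by (intro card_mono) auto
  then show "m \<le> 2 * card {i\<in>{..<m}. f i \<le> M}"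
    using cnt[of "\<lambda>y. y \<le> M"] by simp
qed

section \<open>Deterministic residual bounds\<close>

text \<open>No convexity is needed: the residual inequality only compares the objective at the
  estimator with its value at the true parameter.\<close>
lemma slope_est_basic_inequality:
  fixes \<xi> \<theta> :: "nat \<Rightarrow> real"
  assumes anti: "\<And>i j. 1 \<le> i \<Longrightarrow> i \<le> j \<Longrightarrow> j \<le> d \<Longrightarrow> lam j \<le> lam i"
    and pos: "\<And>j. 1 \<le> j \<Longrightarrow> j \<le> d \<Longrightarrow> lam j \<ge> 0" and st: "st \<ge> 0"
    and Y: "Y = (\<lambda>i. \<theta> i + \<sigma> * \<xi> i)"
  defines "u \<equiv> \<lambda>i. slope_est lam d st Y i - \<theta> i"
  shows "(\<Sum>i<d. (u i)\<^sup>2) \<le> 2 * \<sigma> * (\<Sum>i<d. \<xi> i * u i)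
           + st * (sorted_l1 lam d \<theta> - sorted_l1 lam d (slope_est lam d st Y))"
    and "(\<Sum>i<d. (Y i - slope_est lam d st Y i)\<^sup>2)
           = \<sigma>\<^sup>2 * (\<Sum>i<d. (\<xi> i)\<^sup>2) - 2 * \<sigma> * (\<Sum>i<d. \<xi> i * u i) + (\<Sum>i<d. (u i)\<^sup>2)"
proof -
  define \<theta>' where "\<theta>' = (\<lambda>j. if j < d then \<theta> j else 0)"
  have map_eq: "map (\<lambda>j. \<bar>\<theta>' j\<bar>) [0..<d] = map (\<lambda>j. \<bar>\<theta> j\<bar>) [0..<d]"
    by (simp add: \<theta>'_def)
  have "slope_obj lam d st Y (slope_est lam d st Y) \<le> slope_obj lam d st Y \<theta>'"
    by (rule slope_est_minimises[OF anti pos st]) (auto simp: \<theta>'_def)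
  also have "\<dots> = slope_obj lam d st Y \<theta>"
    unfolding slope_obj_def sorted_l1_def map_eq by (simp add: \<theta>'_def)
  also have "\<dots> = \<sigma>\<^sup>2 * (\<Sum>i<d. (\<xi> i)\<^sup>2) + st * sorted_l1 lam d \<theta>"
    by (simp add: slope_obj_def Y power_mult_distrib sum_distrib_left)
  finally have 1: "(\<Sum>i<d. (Y i - slope_est lam d st Y i)\<^sup>2) + st * sorted_l1 lam d (slope_est lam d st Y)
      \<le> \<sigma>\<^sup>2 * (\<Sum>i<d. (\<xi> i)\<^sup>2) + st * sorted_l1 lam d \<theta>"
    by (simp add: slope_obj_def)
  have "(Y i - slope_est lam d st Y i)\<^sup>2 = \<sigma>\<^sup>2 * (\<xi> i)\<^sup>2 - 2 * \<sigma> * (\<xi> i * u i) + (u i)\<^sup>2" for i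
  proof -
    have "Y i - slope_est lam d st Y i = \<sigma> * \<xi> i - u i"
      by (simp add: u_def Y)
    show ?thesis
      unfolding \<open>Y i - slope_est lam d st Y i = _\<close>
      by (simp add: power2_diff power_mult_distrib)
  qed
  then show 2: "(\<Sum>i<d. (Y i - slope_est lam d st Y i)\<^sup>2)
           = \<sigma>\<^sup>2 * (\<Sum>i<d. (\<xi> i)\<^sup>2) - 2 * \<sigma> * (\<Sum>i<d. \<xi> i * u i) + (\<Sum>i<d. (u i)\<^sup>2)"
    by (simp add: sum.distrib sum_subtractf sum_distrib_left)
  show "(\<Sum>i<d. (u i)\<^sup>2) \<le> 2 * \<sigma> * (\<Sum>i<d. \<xi> i * u i)
           + st * (sorted_l1 lam d \<theta> - sorted_l1 lam d (slope_est lam d st Y))"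
    using 1 2 by (simp add: algebra_simps)
qed

text \<open>Ordering the complement of the support by the size of the noise (rather than by the size of
  the estimation error) is what makes the noise at position \<open>r\<close> an order statistic.\<close>
lemma obtain_support_first_list:
  fixes \<xi> \<theta> :: "nat \<Rightarrow> real"
  assumes "card {i\<in>{..<d}. \<theta> i \<noteq> 0} = k"
  obtains L where "mset L = mset [0..<d]" "distinct L" "set L = {..<d}" "length L = d" "k \<le> d"
    "sorted_wrt (\<ge>) (map (\<lambda>j. \<bar>\<theta> j\<bar>) L)"
    "\<And>r. k \<le> r \<Longrightarrow> r < d \<Longrightarrow> \<theta> (L ! r) = 0"
    "\<And>q r. k \<le> q \<Longrightarrow> q \<le> r \<Longrightarrow> r < d \<Longrightarrow> \<bar>\<xi> (L ! r)\<bar> \<le> \<bar>\<xi> (L ! q)\<bar>"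
proof -
  define L1 where "L1 = sort_key (\<lambda>j. - \<bar>\<theta> j\<bar>) (filter (\<lambda>j. \<theta> j \<noteq> 0) [0..<d])"
  define L2 where "L2 = sort_key (\<lambda>j. - \<bar>\<xi> j\<bar>) (filter (\<lambda>j. \<theta> j = 0) [0..<d])"
  have s1: "set L1 = {i\<in>{..<d}. \<theta> i \<noteq> 0}" and s2: "set L2 = {i\<in>{..<d}. \<theta> i = 0}"
    by (auto simp: L1_def L2_def)
  have "distinct L1" by (simp add: L1_def)
  then have l1: "length L1 = k"
    using assms s1 by (metis distinct_card)
  have ms: "mset (L1 @ L2) = mset [0..<d]"
    using multiset_partition[of "mset [0..<d]" "\<lambda>j. \<theta> j \<noteq> 0"] by (simp add: L1_def L2_def)
  then have len: "length (L1 @ L2) = d"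
    using mset_eq_length[OF ms] by simp
  have "sorted (map (\<lambda>j. - \<bar>\<theta> j\<bar>) L1)" "sorted (map (\<lambda>j. - \<bar>\<xi> j\<bar>) L2)"
    unfolding L1_def L2_def by (rule sorted_sort_key)+
  then have srt: "sorted_wrt (\<ge>) (map (\<lambda>j. \<bar>\<theta> j\<bar>) L1)" "sorted_wrt (\<ge>) (map (\<lambda>j. \<bar>\<xi> j\<bar>) L2)"
    by (simp_all add: sorted_wrt_iff_nth_less)
  have z2: "\<theta> (L2 ! i) = 0" if "i < length L2" for i
    using nth_mem[OF that] s2 by auto
  show thesis
  proof
    show "distinct (L1 @ L2)" "set (L1 @ L2) = {..<d}"
      by (auto simp: L1_def L2_def)
    show "k \<le> d" using len l1 by simp
    have "sorted_wrt (\<ge>) (map (\<lambda>j. \<bar>\<theta> j\<bar>) L2)"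
      using z2 by (simp add: sorted_wrt_iff_nth_less)
    then show "sorted_wrt (\<ge>) (map (\<lambda>j. \<bar>\<theta> j\<bar>) (L1 @ L2))"
      using srt(1) s2 by (auto simp: sorted_wrt_append)
    show "\<theta> ((L1 @ L2) ! r) = 0" if "k \<le> r" "r < d" for r
      using z2[of "r - k"] that len l1 by (simp add: nth_append)
    show "\<bar>\<xi> ((L1 @ L2) ! r)\<bar> \<le> \<bar>\<xi> ((L1 @ L2) ! q)\<bar>" if "k \<le> q" "q \<le> r" "r < d" for q r
      using that srt(2) len l1
      by (cases "q = r") (auto simp: nth_append sorted_wrt_iff_nth_less)
  qed (use ms len in auto)
qed

lemma sum_list_index:
  fixes f :: "nat \<Rightarrow> real"
  assumes "distinct L" "set L = {..<d}" "length L = d"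
  shows "(\<Sum>r<d. f (L ! r)) = (\<Sum>i<d. f i)"
  using assms by (intro sum.reindex_bij_betw bij_betw_nth) simp_all

text \<open>One ordering serves both norms: it attains the norm of \<open>\<theta>\<close> and
  bounds that of \<open>\<theta>'\<close> from below. Before the cut \<open>n\<close> the triangle
  inequality is used; after it \<open>\<theta>\<close> vanishes, so the penalty enters with a
  negative sign. The cut may lie beyond the support size \<open>k\<close>.\<close>

lemma sorted_l1_diff_le:
  fixes \<theta> \<theta>' :: "nat \<Rightarrow> real"
  assumes anti: "\<And>i j. 1 \<le> i \<Longrightarrow> i \<le> j \<Longrightarrow> j \<le> d \<Longrightarrow> lam j \<le> lam i"
    and pos: "\<And>j. 1 \<le> j \<Longrightarrow> j \<le> d \<Longrightarrow> lam j \<ge> 0"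
    and L: "mset L = mset [0..<d]" "sorted_wrt (\<ge>) (map (\<lambda>j. \<bar>\<theta> j\<bar>) L)"
    and z: "\<And>r. k \<le> r \<Longrightarrow> r < d \<Longrightarrow> \<theta> (L ! r) = 0" and "k \<le> n" "n \<le> d"
  shows "sorted_l1 lam d \<theta> - sorted_l1 lam d \<theta>'
    \<le> (\<Sum>r<n. lam (Suc r) * \<bar>\<theta>' (L ! r) - \<theta> (L ! r)\<bar>)
      - (\<Sum>r=n..<d. lam (Suc r) * \<bar>\<theta>' (L ! r) - \<theta> (L ! r)\<bar>)"
proof -
  have "sorted_l1 lam d \<theta> - sorted_l1 lam d \<theta>'
      \<le> (\<Sum>r<d. lam (Suc r) * (\<bar>\<theta> (L ! r)\<bar> - \<bar>\<theta>' (L ! r)\<bar>))"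
    using sorted_l1_eq[OF L, of lam] sorted_l1_ge[OF anti L(1), where \<theta> = \<theta>']
    by (simp add: right_diff_distrib sum_subtractf)
  also have "\<dots> = (\<Sum>r<n. lam (Suc r) * (\<bar>\<theta> (L ! r)\<bar> - \<bar>\<theta>' (L ! r)\<bar>))
      + (\<Sum>r=n..<d. lam (Suc r) * (\<bar>\<theta> (L ! r)\<bar> - \<bar>\<theta>' (L ! r)\<bar>))"
    using sum.atLeastLessThan_concat[of 0 n d "\<lambda>r. lam (Suc r) * (\<bar>\<theta> (L ! r)\<bar> - \<bar>\<theta>' (L ! r)\<bar>)"] \<open>n \<le> d\<close>
    by (simp add: atLeast0LessThan)
  also have "\<dots> \<le> (\<Sum>r<n. lam (Suc r) * \<bar>\<theta>' (L ! r) - \<theta> (L ! r)\<bar>)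
      + (\<Sum>r=n..<d. - (lam (Suc r) * \<bar>\<theta>' (L ! r) - \<theta> (L ! r)\<bar>))"
  proof (intro add_mono sum_mono)
    show "lam (Suc r) * (\<bar>\<theta> (L ! r)\<bar> - \<bar>\<theta>' (L ! r)\<bar>) \<le> lam (Suc r) * \<bar>\<theta>' (L ! r) - \<theta> (L ! r)\<bar>"
      if "r \<in> {..<n}" for r
      using that pos[of "Suc r"] \<open>n \<le> d\<close> by (intro mult_left_mono) auto
    show "lam (Suc r) * (\<bar>\<theta> (L ! r)\<bar> - \<bar>\<theta>' (L ! r)\<bar>) \<le> - (lam (Suc r) * \<bar>\<theta>' (L ! r) - \<theta> (L ! r)\<bar>)"
      if "r \<in> {n..<d}" for r
      using that z[of r] \<open>k \<le> n\<close> by simp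
  qed
  finally show ?thesis by (simp add: sum_negf)
qed

text \<open>The first bound drops the penalty after position \<open>n\<close> and so holds however
  small \<open>st\<close> is. In the second, the noise below \<open>T r\<close> enters the
  comparison of objectives with coefficient \<open>2 * \<sigma>\<close>, at most half of the
  penalty. The other half pays for the same noise when the cross term returns in
  \<open>E\<close>.\<close>

lemma residual_bound:
  fixes \<xi> \<theta> T :: "nat \<Rightarrow> real"
  assumes anti: "\<And>i j. 1 \<le> i \<Longrightarrow> i \<le> j \<Longrightarrow> j \<le> d \<Longrightarrow> lam j \<le> lam i"
    and pos: "\<And>j. 1 \<le> j \<Longrightarrow> j \<le> d \<Longrightarrow> lam j \<ge> 0" and st: "st \<ge> 0" and \<sigma>: "\<sigma> > 0"
    and Y: "Y = (\<lambda>i. \<theta> i + \<sigma> * \<xi> i)"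
    and L: "mset L = mset [0..<d]" "sorted_wrt (\<ge>) (map (\<lambda>j. \<bar>\<theta> j\<bar>) L)"
      "distinct L" "set L = {..<d}" "length L = d"
    and z: "\<And>r. k \<le> r \<Longrightarrow> r < d \<Longrightarrow> \<theta> (L ! r) = 0" and kn: "k \<le> n" "n \<le> d"
  defines "E \<equiv> \<bar>(\<Sum>i<d. (Y i - slope_est lam d st Y i)\<^sup>2) - \<sigma>\<^sup>2 * (\<Sum>i<d. (\<xi> i)\<^sup>2)\<bar>"
    and "\<Lambda> \<equiv> \<Sum>r<n. (lam (Suc r))\<^sup>2"
  shows "E \<le> 17 * \<sigma>\<^sup>2 * (\<Sum>i<d. (\<xi> i)\<^sup>2) + 4 * st\<^sup>2 * \<Lambda>"
    and "(\<And>r. n \<le> r \<Longrightarrow> r < d \<Longrightarrow> 0 \<le> T r \<and> 4 * \<sigma> * T r \<le> st * lam (Suc r)) \<Longrightarrow>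
      E \<le> 2 * (8 * \<sigma>\<^sup>2 * (\<Sum>r<n. (\<xi> (L ! r))\<^sup>2) + 2 * st\<^sup>2 * \<Lambda>
          + 4 * \<sigma>\<^sup>2 * (\<Sum>r=n..<d. (max 0 (\<bar>\<xi> (L ! r)\<bar> - T r))\<^sup>2))"
proof -
  define u where "u = (\<lambda>i. slope_est lam d st Y i - \<theta> i)"
  define v where "v = (\<lambda>r. \<bar>u (L ! r)\<bar>)"
  define \<eta> where "\<eta> = (\<lambda>r. \<bar>\<xi> (L ! r)\<bar>)"
  define D where "D = (\<Sum>i<d. (u i)\<^sup>2)"
  define X where "X = (\<Sum>i<d. \<xi> i * u i)"
  have split: "(\<Sum>r<d. f r) = (\<Sum>r<n. f r) + (\<Sum>r=n..<d. f r)" for f :: "nat \<Rightarrow> real"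
    using sum.atLeastLessThan_concat[of 0 n d f] kn(2) by (simp add: atLeast0LessThan)
  have Dv: "D = (\<Sum>r<d. (v r)\<^sup>2)"
    unfolding D_def v_def by (simp add: sum_list_index[OF L(3-5), of "\<lambda>i. (u i)\<^sup>2"])
  have Sv: "(\<Sum>i<d. (\<xi> i)\<^sup>2) = (\<Sum>r<d. (\<eta> r)\<^sup>2)"
    unfolding \<eta>_def by (simp add: sum_list_index[OF L(3-5), of "\<lambda>i. (\<xi> i)\<^sup>2"])
  have X: "\<bar>X\<bar> \<le> (\<Sum>r<d. \<eta> r * v r)"
  proof -
    have "\<bar>X\<bar> \<le> (\<Sum>i<d. \<bar>\<xi> i\<bar> * \<bar>u i\<bar>)"
      unfolding X_def by (rule order_trans[OF sum_abs]) (simp add: abs_mult)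
    then show ?thesis
      unfolding v_def \<eta>_def by (simp add: sum_list_index[OF L(3-5), of "\<lambda>i. \<bar>\<xi> i\<bar> * \<bar>u i\<bar>"])
  qed
  have v0: "v r \<ge> 0" and \<eta>0: "\<eta> r \<ge> 0" for r
    by (simp_all add: v_def \<eta>_def)
  have bas: "D \<le> 2 * \<sigma> * X + st * (sorted_l1 lam d \<theta> - sorted_l1 lam d (slope_est lam d st Y))"
    using slope_est_basic_inequality(1)[OF anti pos st Y] by (simp add: u_def D_def X_def)
  have E: "E \<le> D + 2 * \<sigma> * \<bar>X\<bar>"
  proof -
    have "(\<Sum>i<d. (Y i - slope_est lam d st Y i)\<^sup>2) - \<sigma>\<^sup>2 * (\<Sum>i<d. (\<xi> i)\<^sup>2) = D - 2 * \<sigma> * X"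
      using slope_est_basic_inequality(2)[OF anti pos st Y] by (simp add: u_def D_def X_def)
    then have "E \<le> \<bar>D\<bar> + \<bar>2 * \<sigma> * X\<bar>"
      unfolding E_def by linarith
    moreover have "D \<ge> 0" by (simp add: D_def sum_nonneg)
    ultimately show ?thesis using \<sigma> by (simp add: abs_mult)
  qed
  have "st * (sorted_l1 lam d \<theta> - sorted_l1 lam d (slope_est lam d st Y))
     \<le> st * ((\<Sum>r<n. lam (Suc r) * v r) - (\<Sum>r=n..<d. lam (Suc r) * v r))"
    using sorted_l1_diff_le[OF anti pos L(1,2) z kn, where \<theta>' = "slope_est lam d st Y"] st
    by (intro mult_left_mono) (simp_all add: v_def u_def)
  then have bas2: "D \<le> 2 * \<sigma> * X + (\<Sum>r<n. st * lam (Suc r) * v r) - (\<Sum>r=n..<d. st * lam (Suc r) * v r)"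
    using bas by (simp add: right_diff_distrib sum_distrib_left mult.assoc)
  have am: "a * b \<le> a\<^sup>2 / 2 + b\<^sup>2 / 2" for a b :: real
    using sum_squares_bound[of a b] by simp
  have sq: "(x + y)\<^sup>2 \<le> 2 * x\<^sup>2 + 2 * y\<^sup>2" for x y :: real
    using sum_squares_bound[of x y] by (simp add: power2_sum)
  have \<sigma>X: "2 * \<sigma> * \<bar>X\<bar> \<le> (\<Sum>r<d. 2 * \<sigma> * \<eta> r * v r)"
    using mult_left_mono[OF X, of "2 * \<sigma>"] \<sigma> by (simp add: sum_distrib_left mult.assoc)
  have XX: "2 * \<sigma> * X \<le> 2 * \<sigma> * \<bar>X\<bar>"
    using \<sigma> by simp
  show "E \<le> 17 * \<sigma>\<^sup>2 * (\<Sum>i<d. (\<xi> i)\<^sup>2) + 4 * st\<^sup>2 * \<Lambda>"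
  proof -
    have "(\<Sum>r=n..<d. st * lam (Suc r) * v r) \<ge> 0"
      using st pos v0 by (intro sum_nonneg mult_nonneg_nonneg) auto
    then have "D \<le> (\<Sum>r<d. 2 * \<sigma> * \<eta> r * v r) + (\<Sum>r<n. st * lam (Suc r) * v r)"
      using bas2 \<sigma>X XX by linarith
    \<comment> \<open>The factors \<open>sqrt 2\<close> leave two quarters of the squared error, at
      most \<open>D / 2\<close> in all, to be moved to the left-hand side.\<close>
    also have "\<dots> \<le> (\<Sum>r<d. 4 * \<sigma>\<^sup>2 * (\<eta> r)\<^sup>2 + (v r)\<^sup>2 / 4) + (\<Sum>r<n. st\<^sup>2 * (lam (Suc r))\<^sup>2 + (v r)\<^sup>2 / 4)"
    proof (intro add_mono sum_mono)
      show "2 * \<sigma> * \<eta> r * v r \<le> 4 * \<sigma>\<^sup>2 * (\<eta> r)\<^sup>2 + (v r)\<^sup>2 / 4" for r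
        using am[of "sqrt 2 * (2 * \<sigma> * \<eta> r)" "v r / sqrt 2"]
        by (simp add: power_mult_distrib power_divide)
      show "st * lam (Suc r) * v r \<le> st\<^sup>2 * (lam (Suc r))\<^sup>2 + (v r)\<^sup>2 / 4" for r
        using am[of "sqrt 2 * (st * lam (Suc r))" "v r / sqrt 2"]
        by (simp add: power_mult_distrib power_divide)
    qed
    also have "\<dots> = 4 * \<sigma>\<^sup>2 * (\<Sum>r<d. (\<eta> r)\<^sup>2) + D / 4 + st\<^sup>2 * \<Lambda> + (\<Sum>r<n. (v r)\<^sup>2) / 4"
      by (simp add: sum.distrib sum_distrib_left Dv \<Lambda>_def sum_divide_distrib)
    finally have "D \<le> 4 * \<sigma>\<^sup>2 * (\<Sum>r<d. (\<eta> r)\<^sup>2) + D / 4 + st\<^sup>2 * \<Lambda> + (\<Sum>r<n. (v r)\<^sup>2) / 4" .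
    moreover have "(\<Sum>r<n. (v r)\<^sup>2) \<le> D"
      unfolding Dv split by (simp add: sum_nonneg)
    ultimately have D: "D \<le> 8 * \<sigma>\<^sup>2 * (\<Sum>r<d. (\<eta> r)\<^sup>2) + 2 * st\<^sup>2 * \<Lambda>"
      by simp
    have "(\<Sum>r<d. 2 * \<sigma> * \<eta> r * v r) \<le> (\<Sum>r<d. \<sigma>\<^sup>2 * (\<eta> r)\<^sup>2 + (v r)\<^sup>2)"
      using sum_squares_bound[of "\<sigma> * \<eta> _" "v _"]
      by (intro sum_mono) (simp add: power_mult_distrib algebra_simps)
    then have "2 * \<sigma> * \<bar>X\<bar> \<le> \<sigma>\<^sup>2 * (\<Sum>r<d. (\<eta> r)\<^sup>2) + D"
      using \<sigma>X by (simp add: sum.distrib sum_distrib_left Dv)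
    then show ?thesis
      using E D Sv by simp
  qed
  assume T: "\<And>r. n \<le> r \<Longrightarrow> r < d \<Longrightarrow> 0 \<le> T r \<and> 4 * \<sigma> * T r \<le> st * lam (Suc r)"
  define w where "w = (\<lambda>r. max 0 (\<eta> r - T r))"
  define Q where "Q = (\<Sum>r<n. (2 * \<sigma> * \<eta> r + st * lam (Suc r))\<^sup>2) + (\<Sum>r=n..<d. (2 * \<sigma> * w r)\<^sup>2)"
  \<comment> \<open>\<open>Z\<close> is the truncated noise after the cut, tested against
    \<open>v\<close>. It occurs with opposite signs in \<open>D + Z \<le> V\<close> and in
    \<open>2 * \<sigma> * |X| \<le> V + Z\<close>, hence \<open>E \<le> 2 * V \<le> Q + D\<close>.
    Since \<open>Z \<ge> 0\<close>, the bound \<open>V \<le> Q / 2 + D / 2\<close> also gives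
    \<open>D \<le> Q\<close>.\<close>
  define Z where "Z = (\<Sum>r=n..<d. 2 * \<sigma> * T r * v r)"
  define V where "V = (\<Sum>r<n. (2 * \<sigma> * \<eta> r + st * lam (Suc r)) * v r) + (\<Sum>r=n..<d. 2 * \<sigma> * w r * v r)"
  have "V \<le> (\<Sum>r<n. (2 * \<sigma> * \<eta> r + st * lam (Suc r))\<^sup>2 / 2 + (v r)\<^sup>2 / 2)
      + (\<Sum>r=n..<d. (2 * \<sigma> * w r)\<^sup>2 / 2 + (v r)\<^sup>2 / 2)"
    unfolding V_def by (intro add_mono sum_mono am)
  also have "\<dots> = Q / 2 + D / 2"
    unfolding Dv split Q_def by (simp add: sum.distrib sum_divide_distrib add_divide_distrib)
  finally have V: "V \<le> Q / 2 + D / 2" .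
  have "(\<Sum>r=n..<d. 2 * \<sigma> * \<eta> r * v r) - (\<Sum>r=n..<d. st * lam (Suc r) * v r) + Z
      \<le> (\<Sum>r=n..<d. 2 * \<sigma> * w r * v r)"
    unfolding Z_def sum_subtractf[symmetric] sum.distrib[symmetric]
  proof (rule sum_mono)
    fix r assume r: "r \<in> {n..<d}"
    have "2 * \<sigma> * \<eta> r \<le> 2 * \<sigma> * (w r + T r)"
      using \<sigma> by (intro mult_left_mono) (auto simp: w_def)
    moreover have "4 * \<sigma> * T r \<le> st * lam (Suc r)" using T r by auto
    ultimately have "2 * \<sigma> * \<eta> r - st * lam (Suc r) + 2 * \<sigma> * T r \<le> 2 * \<sigma> * w r"
      by (simp add: algebra_simps)
    from mult_right_mono[OF this v0[of r]]
    show "2 * \<sigma> * \<eta> r * v r - st * lam (Suc r) * v r + 2 * \<sigma> * T r * v r \<le> 2 * \<sigma> * w r * v r"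
      by (simp add: algebra_simps)
  qed
  moreover have "D \<le> (\<Sum>r<n. 2 * \<sigma> * \<eta> r * v r) + (\<Sum>r=n..<d. 2 * \<sigma> * \<eta> r * v r)
      + (\<Sum>r<n. st * lam (Suc r) * v r) - (\<Sum>r=n..<d. st * lam (Suc r) * v r)"
    using bas2 \<sigma>X XX split[of "\<lambda>r. 2 * \<sigma> * \<eta> r * v r"] by linarith
  ultimately have DZ: "D + Z \<le> V"
    unfolding V_def by (simp add: distrib_right sum.distrib)
  have "(\<Sum>r<d. 2 * \<sigma> * \<eta> r * v r) \<le> V + Z"
    unfolding split V_def Z_def add.assoc sum.distrib[symmetric]
  proof (intro add_mono sum_mono mult_right_mono v0)
    show "2 * \<sigma> * \<eta> r \<le> 2 * \<sigma> * \<eta> r + st * lam (Suc r)" if "r \<in> {..<n}" for r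
      using that st pos[of "Suc r"] kn(2) by simp
    have "\<eta> r \<le> w r + T r" for r by (simp add: w_def)
    from mult_right_mono[OF mult_left_mono[OF this, of "2 * \<sigma>"] v0]
    show "2 * \<sigma> * \<eta> r * v r \<le> 2 * \<sigma> * w r * v r + 2 * \<sigma> * T r * v r" for r
      using \<sigma> by (simp add: algebra_simps)
  qed
  moreover have "Z \<ge> 0"
    using T \<sigma> v0 unfolding Z_def by (intro sum_nonneg mult_nonneg_nonneg) auto
  ultimately have "E \<le> 2 * Q"
    using E \<sigma>X DZ V by linarith
  also have "Q \<le> (\<Sum>r<n. 2 * (2 * \<sigma> * \<eta> r)\<^sup>2 + 2 * (st * lam (Suc r))\<^sup>2) + (\<Sum>r=n..<d. (2 * \<sigma> * w r)\<^sup>2)"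
    unfolding Q_def by (intro add_mono sum_mono sq order_refl)
  also have "\<dots> = 8 * \<sigma>\<^sup>2 * (\<Sum>r<n. (\<eta> r)\<^sup>2) + 2 * st\<^sup>2 * \<Lambda> + 4 * \<sigma>\<^sup>2 * (\<Sum>r=n..<d. (w r)\<^sup>2)"
    by (simp add: sum.distrib sum_distrib_left power_mult_distrib \<Lambda>_def mult.assoc)
  finally show "E \<le> 2 * (8 * \<sigma>\<^sup>2 * (\<Sum>r<n. (\<xi> (L ! r))\<^sup>2) + 2 * st\<^sup>2 * \<Lambda>
          + 4 * \<sigma>\<^sup>2 * (\<Sum>r=n..<d. (max 0 (\<bar>\<xi> (L ! r)\<bar> - T r))\<^sup>2))"
    by (simp add: w_def \<eta>_def)
qed

section \<open>Order statistics of the noise and the median-of-means scale\<close>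

text \<open>If the entry at position \<open>r\<close> exceeds \<open>3 * x\<close> by
  \<open>w\<close>, so does every entry at positions \<open>k\<close> to \<open>r\<close>, and these
  are at least half of the first \<open>Suc r\<close> positions. Each adds at least
  \<open>w + 2 * x\<close> to the sum of excesses over \<open>x\<close>. The parts
  \<open>2 * x\<close> together pay for \<open>e\<close>, and the parts \<open>w\<close> remain
  below the deviation from \<open>e\<close>.\<close>

lemma order_statistic_excess:
  fixes \<xi> :: "nat \<Rightarrow> real"
  assumes L: "distinct L" "set L = {..<d}" "length L = d"
    and desc: "\<And>q r. k \<le> q \<Longrightarrow> q \<le> r \<Longrightarrow> r < d \<Longrightarrow> \<bar>\<xi> (L ! r)\<bar> \<le> \<bar>\<xi> (L ! q)\<bar>"
    and r: "2 * k \<le> Suc r" "k \<le> r" "r < d"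
    and x: "x \<ge> 0" "e \<le> real (Suc r) * x"
  shows "(max 0 (\<bar>\<xi> (L ! r)\<bar> - 3 * x))\<^sup>2
    \<le> 4 / (real (Suc r))\<^sup>2 * ((\<Sum>i<d. max 0 (\<bar>\<xi> i\<bar> - x)) - e)\<^sup>2"
proof (cases "\<bar>\<xi> (L ! r)\<bar> \<le> 3 * x")
  case True
  then show ?thesis by simp
next
  case False
  define l where "l = real (Suc r - k)"
  define w where "w = \<bar>\<xi> (L ! r)\<bar> - 3 * x"
  have w: "w > 0" using False by (simp add: w_def)
  have l: "real (Suc r) \<le> 2 * l" using r by (simp add: l_def of_nat_diff)
  have "l * (w + 2 * x) = (\<Sum>q\<in>{k..<Suc r}. w + 2 * x)"
    by (simp add: l_def)
  also have "\<dots> \<le> (\<Sum>q\<in>{k..<Suc r}. max 0 (\<bar>\<xi> (L ! q)\<bar> - x))"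
  proof (rule sum_mono)
    fix q assume "q \<in> {k..<Suc r}"
    then show "w + 2 * x \<le> max 0 (\<bar>\<xi> (L ! q)\<bar> - x)"
      using desc[of q r] r by (auto simp: w_def)
  qed
  also have "\<dots> \<le> (\<Sum>q<d. max 0 (\<bar>\<xi> (L ! q)\<bar> - x))"
    using r by (intro sum_mono2) auto
  also have "\<dots> = (\<Sum>i<d. max 0 (\<bar>\<xi> i\<bar> - x))"
    by (rule sum_list_index[OF L])
  finally have "l * w \<le> (\<Sum>i<d. max 0 (\<bar>\<xi> i\<bar> - x)) - 2 * l * x"
    by (simp add: algebra_simps)
  also have "\<dots> \<le> (\<Sum>i<d. max 0 (\<bar>\<xi> i\<bar> - x)) - e"
    using mult_right_mono[OF l x(1)] x(2) by simp
  finally have lw: "l * w \<le> (\<Sum>i<d. max 0 (\<bar>\<xi> i\<bar> - x)) - e" .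
  have "real (Suc r) * w \<le> 2 * (l * w)"
    using mult_right_mono[OF l, of w] w by (simp only: mult.assoc)
  also have "\<dots> \<le> 2 * ((\<Sum>i<d. max 0 (\<bar>\<xi> i\<bar> - x)) - e)"
    using lw by (rule mult_left_mono) simp
  finally have "real (Suc r) * w \<le> 2 * ((\<Sum>i<d. max 0 (\<bar>\<xi> i\<bar> - x)) - e)" .
  then have "(real (Suc r) * w)\<^sup>2 \<le> (2 * ((\<Sum>i<d. max 0 (\<bar>\<xi> i\<bar> - x)) - e))\<^sup>2"
    using w by (intro power_mono) auto
  then have "w\<^sup>2 \<le> 4 * ((\<Sum>i<d. max 0 (\<bar>\<xi> i\<bar> - x)) - e)\<^sup>2 / (real (Suc r))\<^sup>2"
    unfolding power_mult_distrib by (subst pos_le_divide_eq) (simp_all add: mult.commute)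
  then show ?thesis
    using w by (simp add: w_def)
qed

text \<open>The head of the list contains the support, where the noise is not ordered. Splitting at
  level \<open>x\<close> charges large values to a sum over all coordinates, which does not depend
  on the list.\<close>

lemma sum_squares_list_prefix_le:
  fixes \<xi> :: "nat \<Rightarrow> real"
  assumes L: "distinct L" "set L = {..<d}" "length L = d" and n: "n \<le> d" and x: "x \<ge> 0"
  shows "(\<Sum>r<n. (\<xi> (L ! r))\<^sup>2)
    \<le> real n * x\<^sup>2 + (\<Sum>i<d. if \<bar>\<xi> i\<bar> > x then (\<xi> i)\<^sup>2 else 0)"
proof -
  have "(\<Sum>r<n. (\<xi> (L ! r))\<^sup>2) \<le> (\<Sum>r<n. x\<^sup>2 + (if \<bar>\<xi> (L ! r)\<bar> > x then (\<xi> (L ! r))\<^sup>2 else 0))"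
  proof (rule sum_mono)
    fix r
    have "(\<xi> (L ! r))\<^sup>2 \<le> x\<^sup>2" if "\<not> \<bar>\<xi> (L ! r)\<bar> > x"
      using that x by (subst abs_le_square_iff[symmetric]) simp
    then show "(\<xi> (L ! r))\<^sup>2 \<le> x\<^sup>2 + (if \<bar>\<xi> (L ! r)\<bar> > x then (\<xi> (L ! r))\<^sup>2 else 0)"
      by auto
  qed
  also have "\<dots> = real n * x\<^sup>2 + (\<Sum>r<n. if \<bar>\<xi> (L ! r)\<bar> > x then (\<xi> (L ! r))\<^sup>2 else 0)"
    by (simp add: sum.distrib)
  also have "(\<Sum>r<n. if \<bar>\<xi> (L ! r)\<bar> > x then (\<xi> (L ! r))\<^sup>2 else 0)
      \<le> (\<Sum>r<d. if \<bar>\<xi> (L ! r)\<bar> > x then (\<xi> (L ! r))\<^sup>2 else 0)"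
    using n by (intro sum_mono2) auto
  also have "\<dots> = (\<Sum>i<d. if \<bar>\<xi> i\<bar> > x then (\<xi> i)\<^sup>2 else 0)"
    by (rule sum_list_index[OF L])
  finally show ?thesis by simp
qed

text \<open>Choosing one support index in each contaminated block is injective because the blocks
  are disjoint.\<close>

lemma card_contaminated_blocks_le:
  assumes "mom_blocks d m B"
  shows "card {i\<in>{..<m}. \<exists>j\<in>B i. \<theta> j \<noteq> (0::real)} \<le> card {i\<in>{..<d}. \<theta> i \<noteq> 0}"
proof -
  define A where "A = {i\<in>{..<m}. \<exists>j\<in>B i. \<theta> j \<noteq> 0}"
  define g where "g = (\<lambda>i. SOME j. j \<in> B i \<and> \<theta> j \<noteq> 0)"
  have g: "g i \<in> B i \<and> \<theta> (g i) \<noteq> 0" if "i \<in> A" for i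
  proof -
    have "\<exists>j. j \<in> B i \<and> \<theta> j \<noteq> 0" using that by (auto simp: A_def)
    from someI_ex[OF this] show ?thesis unfolding g_def .
  qed
  have Am: "i < m" if "i \<in> A" for i
    using that by (simp add: A_def)
  have sub: "B i \<subseteq> {..<d}" if "i < m" for i
    using assms that by (simp add: mom_blocks_def)
  have disj: "B i \<inter> B j = {}" if "i < m" "j < m" "i \<noteq> j" for i j
    using assms that by (simp add: mom_blocks_def)
  have "card A \<le> card {i\<in>{..<d}. \<theta> i \<noteq> 0}"
  proof (rule card_inj_on_le)
    show "inj_on g A"
    proof (rule inj_onI, rule ccontr)
      fix i j assume ij: "i \<in> A" "j \<in> A" "g i = g j" "i \<noteq> j"
      then show False
        using g[of i] g[of j] disj[OF Am Am, of i j] by auto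
    qed
    show "g ` A \<subseteq> {i\<in>{..<d}. \<theta> i \<noteq> 0}"
    proof (rule image_subsetI)
      fix i assume "i \<in> A"
      then show "g i \<in> {i\<in>{..<d}. \<theta> i \<noteq> 0}"
        using g[of i] sub[OF Am, of i] by auto
    qed
  qed simp
  then show ?thesis by (simp only: A_def)
qed

text \<open>At least half of the blocks lie on each side of the median and fewer than a quarter are
  contaminated, so at least \<open>m / 4\<close> clean blocks lie on each side. On a clean block the
  statistic is exactly \<open>\<sigma>^2 * M i\<close>. The lower tail is expressed by the
  deficiency \<open>max 0 (1 - M i)\<close> because it takes values in the unit interval.\<close>

lemma mom_sigma_bounds:
  fixes \<xi> \<theta> :: "nat \<Rightarrow> real"
  assumes blocks: "mom_blocks d m B" and s: "4 * card {i\<in>{..<d}. \<theta> i \<noteq> 0} < m" and \<sigma>: "\<sigma> > 0"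
    and Y: "Y = (\<lambda>i. \<theta> i + \<sigma> * \<xi> i)"
  defines "C \<equiv> {i\<in>{..<m}. \<forall>j\<in>B i. \<theta> j = 0}"
    and "M \<equiv> \<lambda>i. (\<Sum>j\<in>B i. (\<xi> j)\<^sup>2) / real (card (B i))"
  shows "mom_sigma m B Y \<ge> 0"
    and "(mom_sigma m B Y)\<^sup>2 \<le> \<sigma>\<^sup>2 * (4 / real m * (\<Sum>i\<in>C. M i))"
    and "mom_sigma m B Y < \<sigma> / 2 \<Longrightarrow> 3 / 16 * real m \<le> (\<Sum>i\<in>C. max 0 (1 - M i))"
proof -
  define f where "f = (\<lambda>i. (\<Sum>j\<in>B i. (Y j)\<^sup>2) / real (card (B i)))"
  define md where "md = median (map f [0..<m])"
  have m: "m > 0" using s by simp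
  have clean: "f i = \<sigma>\<^sup>2 * M i" if "i \<in> C" for i
    using that by (auto simp: C_def f_def M_def Y power_mult_distrib sum_distrib_left intro!: sum.cong)
  have finC: "finite C" by (simp add: C_def)
  have M0: "M i \<ge> 0" and f0: "f i \<ge> 0" for i
    by (simp_all add: M_def f_def sum_nonneg)
  have count: "real m / 4 \<le> real (card {i\<in>C. Q (f i)})" if "m \<le> 2 * card {i\<in>{..<m}. Q (f i)}" for Q
  proof -
    have "{i\<in>{..<m}. Q (f i)} \<subseteq> {i\<in>C. Q (f i)} \<union> {i\<in>{..<m}. \<exists>j\<in>B i. \<theta> j \<noteq> 0}"
      by (auto simp: C_def)
    then have "card {i\<in>{..<m}. Q (f i)} \<le> card ({i\<in>C. Q (f i)} \<union> {i\<in>{..<m}. \<exists>j\<in>B i. \<theta> j \<noteq> 0})"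
      using finC by (intro card_mono) auto
    also have "\<dots> \<le> card {i\<in>C. Q (f i)} + card {i\<in>{..<m}. \<exists>j\<in>B i. \<theta> j \<noteq> 0}"
      by (rule card_Un_le)
    finally have "m < 4 * card {i\<in>C. Q (f i)}"
      using that s card_contaminated_blocks_le[OF blocks, of \<theta>] by linarith
    then show ?thesis by simp
  qed
  have md0: "md \<ge> 0"
  proof -
    have "{i\<in>{..<m}. f i \<le> md} \<noteq> {}"
      using median_card(2)[OF m, of f] m unfolding md_def[symmetric]
      by (metis card.empty mult_0_right not_less)
    then obtain i where "f i \<le> md" by auto
    then show ?thesis using f0[of i] by linarith
  qed
  have ms: "mom_sigma m B Y = sqrt md"
    by (simp add: mom_sigma_def md_def f_def)
  show "mom_sigma m B Y \<ge> 0"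
    using md0 by (simp add: ms)
  have "real m / 4 * md \<le> real (card {i\<in>C. f i \<ge> md}) * md"
    using count[of "\<lambda>y. y \<ge> md"] median_card(1)[OF m, of f] md0
    by (intro mult_right_mono) (simp_all add: md_def)
  also have "\<dots> = (\<Sum>i\<in>{i\<in>C. f i \<ge> md}. md)" by simp
  also have "\<dots> \<le> (\<Sum>i\<in>{i\<in>C. f i \<ge> md}. f i)" by (intro sum_mono) auto
  also have "\<dots> \<le> (\<Sum>i\<in>C. f i)" using finC f0 by (intro sum_mono2) auto
  also have "\<dots> = \<sigma>\<^sup>2 * (\<Sum>i\<in>C. M i)" using clean by (simp add: sum_distrib_left)
  finally have "md \<le> \<sigma>\<^sup>2 * (4 / real m * (\<Sum>i\<in>C. M i))"
    using m by (simp add: field_simps)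
  then show "(mom_sigma m B Y)\<^sup>2 \<le> \<sigma>\<^sup>2 * (4 / real m * (\<Sum>i\<in>C. M i))"
    using md0 by (simp add: ms)
  assume "mom_sigma m B Y < \<sigma> / 2"
  then have "(mom_sigma m B Y)\<^sup>2 < (\<sigma> / 2)\<^sup>2"
    using md0 by (intro power_strict_mono) (simp_all add: ms)
  then have md: "md < \<sigma>\<^sup>2 / 4"
    using md0 by (simp add: ms power_divide)
  \<comment> \<open>A quarter of the blocks, each with deficiency at least
    \<open>1 - 1 / 4\<close>.\<close>
  have "3 / 16 * real m = real m / 4 * (3 / 4)" by simp
  also have "\<dots> \<le> real (card {i\<in>C. f i \<le> md}) * (3 / 4)"
    using count[of "\<lambda>y. y \<le> md"] median_card(2)[OF m, of f]
    by (intro mult_right_mono) (simp_all add: md_def)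
  also have "\<dots> = (\<Sum>i\<in>{i\<in>C. f i \<le> md}. 3 / 4)" by simp
  also have "\<dots> \<le> (\<Sum>i\<in>{i\<in>C. f i \<le> md}. max 0 (1 - M i))"
  proof (rule sum_mono)
    fix i assume i: "i \<in> {i\<in>C. f i \<le> md}"
    then have "\<sigma>\<^sup>2 * M i \<le> \<sigma>\<^sup>2 * (1 / 4)" using clean[of i] md by auto
    then have "M i \<le> 1 / 4" using \<sigma> by (subst (asm) mult_le_cancel_left_pos) auto
    then show "3 / 4 \<le> max 0 (1 - M i)" by simp
  qed
  also have "\<dots> \<le> (\<Sum>i\<in>C. max 0 (1 - M i))" using finC by (intro sum_mono2) auto
  finally show "3 / 16 * real m \<le> (\<Sum>i\<in>C. max 0 (1 - M i))" .
qed

text \<open>The estimator is bounded by a measurable function of the noise, so its own measurability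
  plays no role. The numbers \<open>e r\<close> and \<open>b\<close> will be the means of the
  sums they are subtracted from.\<close>
lemma sigma_hat2_error_le:
  fixes \<xi> \<theta> \<mu> e :: "nat \<Rightarrow> real"
  assumes blocks: "mom_blocks d m B" and supp: "card {i\<in>{..<d}. \<theta> i \<noteq> 0} \<le> s"
    and s: "1 \<le> s" "4 * s < m" "m \<le> d" and \<sigma>: "\<sigma> > 0" and K: "K > 0"
    and \<mu>1: "\<And>j. 1 \<le> j \<Longrightarrow> j \<le> d \<Longrightarrow> \<mu> j \<ge> 1"
    and anti: "\<And>i j. 1 \<le> i \<Longrightarrow> i \<le> j \<Longrightarrow> j \<le> d \<Longrightarrow> \<mu> j \<le> \<mu> i"
    and e: "\<And>r. r < d \<Longrightarrow> e r \<le> real (Suc r) * (K * \<mu> (Suc r))" and b: "b \<le> real m / 16"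
  defines "C \<equiv> {i\<in>{..<m}. \<forall>j\<in>B i. \<theta> j = 0}"
    and "M \<equiv> \<lambda>i. (\<Sum>j\<in>B i. (\<xi> j)\<^sup>2) / real (card (B i))"
    and "\<Lambda> \<equiv> \<Sum>r<2 * s. (24 * K * \<mu> (Suc r))\<^sup>2"
  shows "\<bar>sigma_hat2 (\<lambda>j. 24 * K * \<mu> j) d m B (\<lambda>i. \<theta> i + \<sigma> * \<xi> i) - \<sigma>\<^sup>2\<bar> \<le> \<sigma>\<^sup>2 *
    (18 * \<bar>(\<Sum>i<d. (\<xi> i)\<^sup>2) / real d - 1\<bar>
     + 17 * (64 / (real m)\<^sup>2 * ((\<Sum>i\<in>C. max 0 (1 - M i)) - b)\<^sup>2)
     + \<Lambda> / real d
     + 2 / real d * (8 * (2 * real s * (K * \<mu> s)\<^sup>2 + (\<Sum>i<d. if \<bar>\<xi> i\<bar> > K * \<mu> s then (\<xi> i)\<^sup>2 else 0))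
        + 2 * (4 / real m * (\<Sum>i\<in>C. M i)) * \<Lambda>
        + 4 * (\<Sum>r=2 * s..<d. 4 / (real (Suc r))\<^sup>2 * ((\<Sum>i<d. max 0 (\<bar>\<xi> i\<bar> - K * \<mu> (Suc r))) - e r)\<^sup>2)))"
    (is "_ \<le> \<sigma>\<^sup>2 * (18 * ?g1 + 17 * ?g2 + \<Lambda> / real d + 2 / real d * (8 * ?g3 + 2 * ?g4 * \<Lambda> + 4 * ?g5))")
proof -
  define k where "k = card {i\<in>{..<d}. \<theta> i \<noteq> 0}"
  define Y where "Y = (\<lambda>i. \<theta> i + \<sigma> * \<xi> i)"
  define lam where "lam = (\<lambda>j. 24 * K * \<mu> j)"
  define st where "st = mom_sigma m B Y"
  define S where "S = (\<Sum>i<d. (\<xi> i)\<^sup>2)"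
  define R where "R = (\<Sum>i<d. (Y i - slope_est lam d st Y i)\<^sup>2)"
  define E where "E = \<bar>R - \<sigma>\<^sup>2 * S\<bar>"
  have d: "d > 0" and m: "m > 0" and n: "2 * s \<le> d" and k: "k \<le> s" "k \<le> 2 * s" and k4: "4 * k < m"
    using s supp by (auto simp: k_def)
  have lam_anti: "\<And>i j. 1 \<le> i \<Longrightarrow> i \<le> j \<Longrightarrow> j \<le> d \<Longrightarrow> lam j \<le> lam i"
    using anti K by (simp add: lam_def)
  have lam_pos: "lam j \<ge> 0" if "1 \<le> j" "j \<le> d" for j
    using \<mu>1[OF that] K by (simp add: lam_def)
  have st: "st \<ge> 0" "st\<^sup>2 \<le> \<sigma>\<^sup>2 * ?g4"
    and low: "st < \<sigma> / 2 \<Longrightarrow> 3 / 16 * real m \<le> (\<Sum>i\<in>C. max 0 (1 - M i))"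
    using mom_sigma_bounds[OF blocks k4[unfolded k_def] \<sigma> Y_def] by (simp_all add: st_def C_def M_def)
  obtain L where L: "mset L = mset [0..<d]" "distinct L" "set L = {..<d}" "length L = d"
      "sorted_wrt (\<ge>) (map (\<lambda>j. \<bar>\<theta> j\<bar>) L)"
    and z: "\<And>r. k \<le> r \<Longrightarrow> r < d \<Longrightarrow> \<theta> (L ! r) = 0"
    and desc: "\<And>q r. k \<le> q \<Longrightarrow> q \<le> r \<Longrightarrow> r < d \<Longrightarrow> \<bar>\<xi> (L ! r)\<bar> \<le> \<bar>\<xi> (L ! q)\<bar>"
    using obtain_support_first_list[OF k_def[symmetric], of \<xi>] by metis
  have \<Lambda>: "(\<Sum>r<2 * s. (lam (Suc r))\<^sup>2) = \<Lambda>"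
    by (simp add: \<Lambda>_def lam_def)
  have \<Lambda>0: "\<Lambda> \<ge> 0"
    by (simp add: \<Lambda>_def sum_nonneg)
  \<comment> \<open>The cut is at \<open>2 * s\<close> rather than \<open>s\<close>, so that at
    every later position at least half of the positions up to it are ordered by the noise, as
    \<open>order_statistic_excess\<close> demands.\<close>
  note bounds = residual_bound[where lam = lam and n = "2 * s" and k = k, OF lam_anti lam_pos st(1) \<sigma> Y_def L(1,5,2-4) z k(2) n, unfolded \<Lambda>,
      folded S_def R_def, folded E_def]
  have g3: "?g3 \<ge> 0" and g5: "?g5 \<ge> 0"
    by (simp_all add: sum_nonneg)
  have g4: "?g4 \<ge> 0"
    by (simp add: M_def sum_nonneg)
  have nonneg: "0 \<le> 2 / real d * (8 * x + 2 * y * \<Lambda> + 4 * z)" if "0 \<le> x" "0 \<le> y" "0 \<le> z" for x y z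
    using that \<Lambda>0 by simp
  have extend1: "\<sigma>\<^sup>2 * (17 * (x + y) + l) \<le> \<sigma>\<^sup>2 * (17 * x + 17 * y + l + w)" if "0 \<le> w" for x y l w
    using that by (intro mult_left_mono) simp_all
  have extend2: "\<sigma>\<^sup>2 * w \<le> \<sigma>\<^sup>2 * (17 * x + 17 * y + l + w)" if "0 \<le> x" "0 \<le> y" "0 \<le> l" for x y l w
    using that by (intro mult_left_mono) simp_all
  have combine: "\<sigma>\<^sup>2 * x + \<sigma>\<^sup>2 * (17 * x + y + l + w) = \<sigma>\<^sup>2 * (18 * x + y + l + w)" for x y l w
    by (simp add: algebra_simps)
  have err: "\<bar>R / real d - \<sigma>\<^sup>2\<bar> \<le> \<sigma>\<^sup>2 * ?g1 + E / real d"
  proof -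
    have "R / real d - \<sigma>\<^sup>2 = (R - \<sigma>\<^sup>2 * S) / real d + \<sigma>\<^sup>2 * (S / real d - 1)"
      using d by (simp add: field_simps)
    then have "\<bar>R / real d - \<sigma>\<^sup>2\<bar> \<le> \<bar>(R - \<sigma>\<^sup>2 * S) / real d\<bar> + \<bar>\<sigma>\<^sup>2 * (S / real d - 1)\<bar>"
      by (simp only: abs_triangle_ineq)
    then show ?thesis
      by (simp add: E_def S_def abs_mult)
  qed
  have "E / real d \<le> \<sigma>\<^sup>2 * (17 * ?g1 + 17 * ?g2 + \<Lambda> / real d + 2 / real d * (8 * ?g3 + 2 * ?g4 * \<Lambda> + 4 * ?g5))"
  proof (cases "st < \<sigma> / 2")
    case True
    \<comment> \<open>\<open>3 / 16 - 1 / 16 = 1 / 8\<close>. Hence \<open>?g2\<close>, the squared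
      deviation divided by \<open>(m / 8)^2\<close>, is at least 1 here and takes the place of the
      indicator of this case.\<close>
    have "real m / 8 \<le> (\<Sum>i\<in>C. max 0 (1 - M i)) - b"
      using low[OF True] b by linarith
    then have "(real m / 8)\<^sup>2 \<le> ((\<Sum>i\<in>C. max 0 (1 - M i)) - b)\<^sup>2"
      by (intro power_mono) auto
    then have one: "1 \<le> ?g2"
      using m by (simp add: field_simps)
    have "st\<^sup>2 \<le> (\<sigma> / 2)\<^sup>2"
      using True st(1) by (intro power_mono) auto
    then have "4 * st\<^sup>2 * \<Lambda> \<le> \<sigma>\<^sup>2 * \<Lambda>"
      using \<Lambda>0 by (intro mult_right_mono) (simp_all add: power_divide)
    then have "E \<le> 17 * \<sigma>\<^sup>2 * S + \<sigma>\<^sup>2 * \<Lambda>"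
      using bounds(1) by linarith
    then have "E / real d \<le> (17 * \<sigma>\<^sup>2 * S + \<sigma>\<^sup>2 * \<Lambda>) / real d"
      by (rule divide_right_mono) simp
    also have "\<dots> = \<sigma>\<^sup>2 * (17 * (S / real d) + \<Lambda> / real d)"
      by (simp add: algebra_simps add_divide_distrib)
    also have "\<dots> \<le> \<sigma>\<^sup>2 * (17 * (?g1 + ?g2) + \<Lambda> / real d)"
    proof -
      \<comment> \<open>The constant part of the energy goes to \<open>?g2\<close> and its
        fluctuation to \<open>?g1\<close>; these 17 copies of \<open>?g1\<close> and the one from
        \<open>err\<close> make the coefficient 18.\<close>
      have "S / real d \<le> ?g1 + ?g2"
        using one abs_ge_self[of "S / real d - 1"] unfolding S_def by linarith
      then show ?thesis by (intro mult_left_mono add_mono order_refl) simp_all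
    qed
    also have "\<dots> \<le> \<sigma>\<^sup>2 * (17 * ?g1 + 17 * ?g2 + \<Lambda> / real d + 2 / real d * (8 * ?g3 + 2 * ?g4 * \<Lambda> + 4 * ?g5))"
      by (rule extend1) (rule nonneg[OF g3 g4 g5])
    finally show ?thesis .
  next
    case False
    have "E \<le> 2 * (8 * \<sigma>\<^sup>2 * (\<Sum>r<2 * s. (\<xi> (L ! r))\<^sup>2) + 2 * st\<^sup>2 * \<Lambda>
          + 4 * \<sigma>\<^sup>2 * (\<Sum>r=2 * s..<d. (max 0 (\<bar>\<xi> (L ! r)\<bar> - 3 * (K * \<mu> (Suc r))))\<^sup>2))"
    proof (rule bounds(2))
      fix r assume "2 * s \<le> r" "r < d"
      then have "\<mu> (Suc r) \<ge> 1" using \<mu>1 by simp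
      \<comment> \<open>\<open>24 / 2 = 4 * 3\<close>: the scale loses a factor 2, and the
        truncation level is \<open>3 * (K * \<mu> (Suc r))\<close>.\<close>
      moreover have "\<sigma> / 2 * (24 * (K * \<mu> (Suc r))) \<le> st * (24 * (K * \<mu> (Suc r)))"
        using False K calculation by (intro mult_right_mono) auto
      ultimately show "0 \<le> 3 * (K * \<mu> (Suc r)) \<and> 4 * \<sigma> * (3 * (K * \<mu> (Suc r))) \<le> st * lam (Suc r)"
        using K by (simp add: lam_def mult.assoc)
    qed
    also have "\<dots> \<le> 2 * (8 * \<sigma>\<^sup>2 * ?g3 + 2 * (\<sigma>\<^sup>2 * ?g4) * \<Lambda> + 4 * \<sigma>\<^sup>2 * ?g5)"
    proof (intro mult_left_mono add_mono mult_right_mono sum_mono st(2) \<Lambda>0)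
      show "(\<Sum>r<2 * s. (\<xi> (L ! r))\<^sup>2) \<le> ?g3"
        using sum_squares_list_prefix_le[OF L(2-4) n, of "K * \<mu> s" \<xi>] K \<mu>1[of s] s by simp
      fix r assume r: "r \<in> {2 * s..<d}"
      show "(max 0 (\<bar>\<xi> (L ! r)\<bar> - 3 * (K * \<mu> (Suc r))))\<^sup>2
          \<le> 4 / (real (Suc r))\<^sup>2 * ((\<Sum>i<d. max 0 (\<bar>\<xi> i\<bar> - K * \<mu> (Suc r))) - e r)\<^sup>2"
        using r k K \<mu>1[of "Suc r"] e[of r]
        by (intro order_statistic_excess[where k = k and \<xi> = \<xi>, OF L(2-4) desc]) auto
    qed simp_all
    finally have "E / real d \<le> (2 * (8 * \<sigma>\<^sup>2 * ?g3 + 2 * (\<sigma>\<^sup>2 * ?g4) * \<Lambda> + 4 * \<sigma>\<^sup>2 * ?g5)) / real d"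
      by (rule divide_right_mono) simp
    also have "\<dots> = \<sigma>\<^sup>2 * (2 / real d * (8 * ?g3 + 2 * ?g4 * \<Lambda> + 4 * ?g5))"
      by (simp add: algebra_simps add_divide_distrib)
    also have "\<dots> \<le> \<sigma>\<^sup>2 * (17 * ?g1 + 17 * ?g2 + \<Lambda> / real d + 2 / real d * (8 * ?g3 + 2 * ?g4 * \<Lambda> + 4 * ?g5))"
      using \<Lambda>0 by (intro extend2) simp_all
    finally show ?thesis .
  qed
  from order_trans[OF err add_left_mono[OF this]]
  have "\<bar>R / real d - \<sigma>\<^sup>2\<bar> \<le> \<sigma>\<^sup>2 *
      (18 * ?g1 + 17 * ?g2 + \<Lambda> / real d + 2 / real d * (8 * ?g3 + 2 * ?g4 * \<Lambda> + 4 * ?g5))"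
    unfolding combine .
  moreover have "sigma_hat2 (\<lambda>j. 24 * K * \<mu> j) d m B (\<lambda>i. \<theta> i + \<sigma> * \<xi> i) = R / real d"
    by (simp add: sigma_hat2_def Let_def R_def sum_divide_distrib st_def Y_def lam_def)
  ultimately show ?thesis by simp
qed

section \<open>Second moments of independent sums\<close>

context prob_space
begin

text \<open>Off-diagonal terms vanish by independence. Each variance is enlarged to the raw second
  moment, the form in which the truncated variables are estimated later.\<close>

lemma indep_vars_sum_variance_le:
  fixes X :: "'i \<Rightarrow> 'a \<Rightarrow> real"
  assumes I: "finite I" and ind: "indep_vars (\<lambda>_. borel) X I"
    and sq: "\<And>i. i \<in> I \<Longrightarrow> integrable M (\<lambda>\<omega>. (X i \<omega>)\<^sup>2)"
  shows "integrable M (\<lambda>\<omega>. ((\<Sum>i\<in>I. X i \<omega>) - (\<Sum>i\<in>I. expectation (X i)))\<^sup>2)"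
    and "expectation (\<lambda>\<omega>. ((\<Sum>i\<in>I. X i \<omega>) - (\<Sum>i\<in>I. expectation (X i)))\<^sup>2)
      \<le> (\<Sum>i\<in>I. expectation (\<lambda>\<omega>. (X i \<omega>)\<^sup>2))"
proof -
  define Z where "Z = (\<lambda>i \<omega>. X i \<omega> - expectation (X i))"
  have rv: "X i \<in> borel_measurable M" if "i \<in> I" for i
    using ind that by (auto simp: indep_vars_def2)
  have int: "integrable M (X i)" if "i \<in> I" for i
    using square_integrable_imp_integrable[OF rv[OF that] sq[OF that]] .
  have Zint: "integrable M (Z i)" if "i \<in> I" for i
    using int[OF that] by (simp add: Z_def)
  have Z0: "expectation (Z i) = 0" if "i \<in> I" for i
    using int[OF that] by (simp add: Z_def prob_space)
  have Zind: "indep_vars (\<lambda>_. borel) Z I"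
    unfolding Z_def by (rule indep_vars_compose2[OF ind]) simp
  have Zsq: "integrable M (\<lambda>\<omega>. Z i \<omega> * Z i \<omega>)" if "i \<in> I" for i
    using sq[OF that] int[OF that] by (simp add: Z_def algebra_simps power2_eq_square)
  have var: "expectation (\<lambda>\<omega>. Z i \<omega> * Z i \<omega>) \<le> expectation (\<lambda>\<omega>. (X i \<omega>)\<^sup>2)" if "i \<in> I" for i
    using variance_eq[OF int[OF that] sq[OF that]] by (simp add: Z_def power2_eq_square)
  have off: "integrable M (\<lambda>\<omega>. Z i \<omega> * Z j \<omega>)" "expectation (\<lambda>\<omega>. Z i \<omega> * Z j \<omega>) = 0"
    if "i \<in> I" "j \<in> I" "i \<noteq> j" for i j
  proof -
    have sub: "indep_vars (\<lambda>_. borel) Z {i, j}"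
      using that by (intro indep_vars_subset[OF Zind]) auto
    have "integrable M (\<lambda>\<omega>. \<Prod>l\<in>{i, j}. Z l \<omega>)"
      using that Zint by (intro indep_vars_integrable[OF _ sub]) auto
    moreover have "expectation (\<lambda>\<omega>. \<Prod>l\<in>{i, j}. Z l \<omega>) = (\<Prod>l\<in>{i, j}. expectation (Z l))"
      using that Zint by (intro indep_vars_lebesgue_integral[OF _ sub]) auto
    ultimately show "integrable M (\<lambda>\<omega>. Z i \<omega> * Z j \<omega>)" "expectation (\<lambda>\<omega>. Z i \<omega> * Z j \<omega>) = 0"
      using that Z0 by simp_all
  qed
  have eq: "((\<Sum>i\<in>I. X i \<omega>) - (\<Sum>i\<in>I. expectation (X i)))\<^sup>2 = (\<Sum>i\<in>I. \<Sum>j\<in>I. Z i \<omega> * Z j \<omega>)" for \<omega>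
    by (simp add: Z_def power2_eq_square sum_product flip: sum_subtractf)
  have all: "integrable M (\<lambda>\<omega>. Z i \<omega> * Z j \<omega>)" if "i \<in> I" "j \<in> I" for i j
    using that off Zsq by (cases "i = j") auto
  show "integrable M (\<lambda>\<omega>. ((\<Sum>i\<in>I. X i \<omega>) - (\<Sum>i\<in>I. expectation (X i)))\<^sup>2)"
    unfolding eq by (intro Bochner_Integration.integrable_sum all)
  have "expectation (\<lambda>\<omega>. \<Sum>i\<in>I. \<Sum>j\<in>I. Z i \<omega> * Z j \<omega>)
      = (\<Sum>i\<in>I. \<Sum>j\<in>I. expectation (\<lambda>\<omega>. Z i \<omega> * Z j \<omega>))"
    by (simp add: Bochner_Integration.integral_sum all)
  also have "\<dots> = (\<Sum>i\<in>I. \<Sum>j\<in>I. if i = j then expectation (\<lambda>\<omega>. Z i \<omega> * Z i \<omega>) else 0)"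
    using off by (intro sum.cong refl) auto
  also have "\<dots> = (\<Sum>i\<in>I. expectation (\<lambda>\<omega>. Z i \<omega> * Z i \<omega>))"
    using I by simp
  also have "\<dots> \<le> (\<Sum>i\<in>I. expectation (\<lambda>\<omega>. (X i \<omega>)\<^sup>2))"
    by (intro sum_mono var)
  finally show "expectation (\<lambda>\<omega>. ((\<Sum>i\<in>I. X i \<omega>) - (\<Sum>i\<in>I. expectation (X i)))\<^sup>2)
      \<le> (\<Sum>i\<in>I. expectation (\<lambda>\<omega>. (X i \<omega>)\<^sup>2))"
    unfolding eq .
qed

end

lemma indep_vars_PiM_coordinates:
  assumes P: "prob_space P" "sets P = sets borel"
  shows "prob_space.indep_vars (PiM I (\<lambda>_. P)) (\<lambda>_. borel) (\<lambda>i \<omega>. \<omega> i) I"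
proof -
  interpret M: prob_space "PiM I (\<lambda>_. P)"
    by (intro prob_space_PiM P)
  have "M.indep_vars (\<lambda>_. P) (\<lambda>i \<omega>. \<omega> i) I"
  proof (cases "I = {}")
    case True
    show ?thesis unfolding M.indep_vars_def2 M.indep_sets_def using True by simp
  next
    case False
    have "distr (PiM I (\<lambda>_. P)) (PiM I (\<lambda>_. P)) (\<lambda>x. \<lambda>i\<in>I. x i)
        = distr (PiM I (\<lambda>_. P)) (PiM I (\<lambda>_. P)) (\<lambda>x. x)"
      by (intro distr_cong refl) (auto simp: space_PiM)
    also have "\<dots> = PiM I (\<lambda>i. distr (PiM I (\<lambda>_. P)) P (\<lambda>\<omega>. \<omega> i))"
      by (subst distr_id, intro PiM_cong refl, rule distr_PiM_component[symmetric]) (simp_all add: P)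
    finally show ?thesis
      using False by (subst M.indep_vars_iff_distr_eq_PiM') auto
  qed
  from M.indep_vars_compose2[OF this, of "\<lambda>_ x. x" "\<lambda>_. borel"] show ?thesis
    using P by (simp add: measurable_ident_sets)
qed

lemma integral_PiM_coordinate:
  fixes f :: "real \<Rightarrow> real"
  assumes P: "prob_space P" "sets P = sets borel" and i: "i \<in> I" and f: "integrable P f"
  shows "integrable (PiM I (\<lambda>_. P)) (\<lambda>\<omega>. f (\<omega> i))"
    and "(\<integral>\<omega>. f (\<omega> i) \<partial>PiM I (\<lambda>_. P)) = (\<integral>x. f x \<partial>P)"
proof -
  have distr: "distr (PiM I (\<lambda>_. P)) P (\<lambda>\<omega>. \<omega> i) = P"
    using P i by (intro distr_PiM_component) auto
  have meas: "(\<lambda>\<omega>. \<omega> i) \<in> PiM I (\<lambda>_. P) \<rightarrow>\<^sub>M P"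
    using i by simp
  show "integrable (PiM I (\<lambda>_. P)) (\<lambda>\<omega>. f (\<omega> i))"
    using f integrable_distr_eq[OF meas, of f] by (simp add: distr borel_measurable_integrable)
  show "(\<integral>\<omega>. f (\<omega> i) \<partial>PiM I (\<lambda>_. P)) = (\<integral>x. f x \<partial>P)"
    using f integral_distr[OF meas, of f] by (simp add: distr borel_measurable_integrable)
qed

lemma iid_sum_variance_le:
  fixes f :: "real \<Rightarrow> real"
  assumes P: "prob_space P" "sets P = sets borel" and f: "f \<in> borel_measurable borel"
    and sq: "integrable P (\<lambda>x. (f x)\<^sup>2)" and B: "finite I" "B \<subseteq> I"
  shows "integrable (PiM I (\<lambda>_. P)) (\<lambda>\<omega>. ((\<Sum>i\<in>B. f (\<omega> i)) - real (card B) * (\<integral>x. f x \<partial>P))\<^sup>2)"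
    and "(\<integral>\<omega>. ((\<Sum>i\<in>B. f (\<omega> i)) - real (card B) * (\<integral>x. f x \<partial>P))\<^sup>2 \<partial>PiM I (\<lambda>_. P))
      \<le> real (card B) * (\<integral>x. (f x)\<^sup>2 \<partial>P)"
proof -
  interpret P: prob_space P by fact
  interpret M: prob_space "PiM I (\<lambda>_. P)"
    by (intro prob_space_PiM P)
  have "f \<in> borel_measurable P"
    using f P(2) by (simp cong: measurable_cong_sets)
  then have f1: "integrable P f"
    using sq by (rule P.square_integrable_imp_integrable)
  have ind: "M.indep_vars (\<lambda>_. borel) (\<lambda>i \<omega>. f (\<omega> i)) B"
    by (rule M.indep_vars_compose2[OF M.indep_vars_subset[OF indep_vars_PiM_coordinates[OF P] B(2)]]) (rule f)
  have finB: "finite B" using B by (rule finite_subset[rotated])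
  have sq': "integrable (PiM I (\<lambda>_. P)) (\<lambda>\<omega>. (f (\<omega> i))\<^sup>2)" if "i \<in> B" for i
    using that B by (intro integral_PiM_coordinate(1)[OF P _ sq]) auto
  have e1: "(\<Sum>i\<in>B. \<integral>\<omega>. f (\<omega> i) \<partial>PiM I (\<lambda>_. P)) = real (card B) * (\<integral>x. f x \<partial>P)"
    using B by (subst sum.cong[OF refl integral_PiM_coordinate(2)[OF P _ f1]]) auto
  have e2: "(\<Sum>i\<in>B. \<integral>\<omega>. (f (\<omega> i))\<^sup>2 \<partial>PiM I (\<lambda>_. P)) = real (card B) * (\<integral>x. (f x)\<^sup>2 \<partial>P)"
    using B by (subst sum.cong[OF refl integral_PiM_coordinate(2)[OF P _ sq]]) auto
  show "integrable (PiM I (\<lambda>_. P)) (\<lambda>\<omega>. ((\<Sum>i\<in>B. f (\<omega> i)) - real (card B) * (\<integral>x. f x \<partial>P))\<^sup>2)"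
    using M.indep_vars_sum_variance_le(1)[OF finB ind sq'] by (simp add: e1)
  show "(\<integral>\<omega>. ((\<Sum>i\<in>B. f (\<omega> i)) - real (card B) * (\<integral>x. f x \<partial>P))\<^sup>2 \<partial>PiM I (\<lambda>_. P))
      \<le> real (card B) * (\<integral>x. (f x)\<^sup>2 \<partial>P)"
    using M.indep_vars_sum_variance_le(2)[OF finB ind sq'] by (simp add: e1 e2)
qed

text \<open>The block mean has variance at most \<open>\<kappa> / n0 \<le> 1 / 256\<close>. The
  inequality \<open>max 0 t \<le> 1 / 32 + 8 * t^2\<close>, which is
  \<open>(16 * t - 1)^2 \<ge> 0\<close> for positive \<open>t\<close>, turns this into
  \<open>1 / 32 + 8 / 256 = 1 / 16\<close>. This is the origin of the condition
  \<open>256 * \<kappa> \<le> n0\<close>.\<close>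

lemma block_deficiency_mean_le:
  fixes B :: "nat set" and n0 :: nat
  assumes P: "std_noise P" and x4: "integrable P (\<lambda>x. x ^ 4)" "(\<integral>x. x ^ 4 \<partial>P) \<le> \<kappa>"
    and B: "finite I" "B \<subseteq> I" "n0 \<le> card B" and n0: "1 \<le> n0" "256 * \<kappa> \<le> real n0"
  shows "integrable (PiM I (\<lambda>_. P)) (\<lambda>\<omega>. max 0 (1 - (\<Sum>j\<in>B. (\<omega> j)\<^sup>2) / real (card B)))"
    and "(\<integral>\<omega>. max 0 (1 - (\<Sum>j\<in>B. (\<omega> j)\<^sup>2) / real (card B)) \<partial>PiM I (\<lambda>_. P)) \<le> 1 / 16"
proof -
  define N where "N = real (card B)"
  define M where "M = (\<lambda>\<omega>::nat \<Rightarrow> real. (\<Sum>j\<in>B. (\<omega> j)\<^sup>2) / N)"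
  have P': "prob_space P" "sets P = sets borel" "integrable P (\<lambda>x. x\<^sup>2)" "(\<integral>x. x\<^sup>2 \<partial>P) = 1"
    using P by (auto simp: std_noise_def)
  interpret PI: prob_space "PiM I (\<lambda>_. P)" by (intro prob_space_PiM P')
  have N: "N \<ge> real n0" "N > 0" using B n0 by (simp_all add: N_def)
  have sq_int: "integrable (PiM I (\<lambda>_. P)) (\<lambda>\<omega>. (\<omega> j)\<^sup>2)" if "j \<in> B" for j
    using that B by (intro integral_PiM_coordinate(1)[OF P'(1,2) _ P'(3)]) auto
  then have Mint: "integrable (PiM I (\<lambda>_. P)) M"
    unfolding M_def by (intro integrable_divide Bochner_Integration.integrable_sum)
  have i4: "integrable P (\<lambda>x::real. (x\<^sup>2)\<^sup>2)" using x4(1) by (simp flip: power_mult)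
  note var = iid_sum_variance_le[OF P'(1,2) _ i4 B(1,2)]
  have e: "(1 - M \<omega>)\<^sup>2 = ((\<Sum>j\<in>B. (\<omega> j)\<^sup>2) - N)\<^sup>2 / N\<^sup>2" for \<omega>
  proof -
    have "1 - M \<omega> = - (((\<Sum>j\<in>B. (\<omega> j)\<^sup>2) - N) / N)"
      using N by (simp add: M_def field_simps)
    then show ?thesis by (simp add: power_divide)
  qed
  have vint: "integrable (PiM I (\<lambda>_. P)) (\<lambda>\<omega>. (1 - M \<omega>)\<^sup>2)"
    unfolding e using var(1) by (simp add: P' N_def)
  have "(\<integral>\<omega>. (1 - M \<omega>)\<^sup>2 \<partial>PiM I (\<lambda>_. P)) \<le> N * \<kappa> / N\<^sup>2"
  proof -
    have "(\<integral>\<omega>. ((\<Sum>j\<in>B. (\<omega> j)\<^sup>2) - N)\<^sup>2 \<partial>PiM I (\<lambda>_. P)) \<le> N * (\<integral>x. x ^ 4 \<partial>P)"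
      using var(2) by (simp add: P' N_def flip: power_mult)
    also have "\<dots> \<le> N * \<kappa>" using x4(2) N by (intro mult_left_mono) auto
    finally show ?thesis unfolding e by (simp add: divide_right_mono)
  qed
  also have "\<dots> \<le> 1 / 256"
    using N n0 by (simp add: power2_eq_square field_simps)
  finally have v: "(\<integral>\<omega>. (1 - M \<omega>)\<^sup>2 \<partial>PiM I (\<lambda>_. P)) \<le> 1 / 256" .
  have "integrable (PiM I (\<lambda>_. P)) (\<lambda>\<omega>. max 0 (1 - M \<omega>))"
    using Mint by (intro integrable_max) simp_all
  then show int: "integrable (PiM I (\<lambda>_. P)) (\<lambda>\<omega>. max 0 (1 - (\<Sum>j\<in>B. (\<omega> j)\<^sup>2) / real (card B)))"
    by (simp add: M_def N_def)
  have "(\<integral>\<omega>. max 0 (1 - M \<omega>) \<partial>PiM I (\<lambda>_. P)) \<le> (\<integral>\<omega>. 1 / 32 + 8 * (1 - M \<omega>)\<^sup>2 \<partial>PiM I (\<lambda>_. P))"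
  proof (rule integral_mono)
    have "max 0 t \<le> 1 / 32 + 8 * t\<^sup>2" for t :: real
      using zero_le_power2[of "16 * t - 1"] by (auto simp: power2_eq_square algebra_simps)
    then show "max 0 (1 - M \<omega>) \<le> 1 / 32 + 8 * (1 - M \<omega>)\<^sup>2" for \<omega> .
  qed (use int vint in \<open>simp_all add: M_def N_def\<close>)
  also have "\<dots> = 1 / 32 + 8 * (\<integral>\<omega>. (1 - M \<omega>)\<^sup>2 \<partial>PiM I (\<lambda>_. P))"
    using vint by (simp add: PI.prob_space)
  also have "\<dots> \<le> 1 / 16" using v by simp
  finally show "(\<integral>\<omega>. max 0 (1 - (\<Sum>j\<in>B. (\<omega> j)\<^sup>2) / real (card B)) \<partial>PiM I (\<lambda>_. P)) \<le> 1 / 16"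
    by (simp add: M_def N_def)
qed

text \<open>The deficiencies are functions of disjoint groups of coordinates, hence independent, and
  lie between 0 and 1, so each has second moment at most 1.\<close>

lemma block_deficiency_variance_le:
  fixes B :: "nat \<Rightarrow> nat set"
  assumes P: "prob_space P" "sets P = sets borel"
    and C: "finite C" "\<And>i. i \<in> C \<Longrightarrow> B i \<subseteq> I" "disjoint_family_on B C"
  defines "X \<equiv> \<lambda>i \<omega>. max 0 (1 - (\<Sum>j\<in>B i. (\<omega> j)\<^sup>2) / real (card (B i)))"
  shows "integrable (PiM I (\<lambda>_. P)) (\<lambda>\<omega>. ((\<Sum>i\<in>C. X i \<omega>) - (\<Sum>i\<in>C. \<integral>\<omega>. X i \<omega> \<partial>PiM I (\<lambda>_. P)))\<^sup>2)"
    and "(\<integral>\<omega>. ((\<Sum>i\<in>C. X i \<omega>) - (\<Sum>i\<in>C. \<integral>\<omega>. X i \<omega> \<partial>PiM I (\<lambda>_. P)))\<^sup>2 \<partial>PiM I (\<lambda>_. P)) \<le> real (card C)"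
proof -
  interpret PI: prob_space "PiM I (\<lambda>_. P)" by (intro prob_space_PiM P)
  define f where "f = (\<lambda>i \<omega>. max 0 (1 - (\<Sum>j\<in>B i. (\<omega> j)\<^sup>2) / real (card (B i))) :: real)"
  have "PI.indep_vars (\<lambda>j. PiM (B j) (\<lambda>_. borel)) (\<lambda>j \<omega>. restrict (\<lambda>i. \<omega> i) (B j)) C"
    by (rule PI.indep_vars_restrict[OF indep_vars_PiM_coordinates[OF P] C(2,3)])
  then have "PI.indep_vars (\<lambda>_. borel) (\<lambda>j \<omega>. f j (restrict (\<lambda>i. \<omega> i) (B j))) C"
    by (rule PI.indep_vars_compose2) (simp add: f_def)
  moreover have "(\<lambda>\<omega>. f j (restrict (\<lambda>i. \<omega> i) (B j))) = X j" for j
    by (simp add: f_def X_def)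
  ultimately have ind: "PI.indep_vars (\<lambda>_. borel) X C"
    by simp
  have X01: "0 \<le> X i \<omega>" "X i \<omega> \<le> 1" for i \<omega>
    by (simp_all add: X_def sum_nonneg)
  have rv: "X i \<in> borel_measurable (PiM I (\<lambda>_. P))" if "i \<in> C" for i
    using ind that by (auto simp: PI.indep_vars_def2)
  have Xsq: "(X i \<omega>)\<^sup>2 \<le> 1" for i \<omega>
    using X01 by (simp add: power_le_one)
  have sq: "integrable (PiM I (\<lambda>_. P)) (\<lambda>\<omega>. (X i \<omega>)\<^sup>2)" if "i \<in> C" for i
    using rv[OF that] Xsq by (intro PI.integrable_const_bound[of _ 1]) auto
  show "integrable (PiM I (\<lambda>_. P)) (\<lambda>\<omega>. ((\<Sum>i\<in>C. X i \<omega>) - (\<Sum>i\<in>C. \<integral>\<omega>. X i \<omega> \<partial>PiM I (\<lambda>_. P)))\<^sup>2)"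
    by (rule PI.indep_vars_sum_variance_le(1)[OF C(1) ind sq])
  have "(\<integral>\<omega>. (X i \<omega>)\<^sup>2 \<partial>PiM I (\<lambda>_. P)) \<le> 1" if "i \<in> C" for i
    using Xsq by (intro PI.integral_le_const sq that) auto
  then have "(\<Sum>i\<in>C. \<integral>\<omega>. (X i \<omega>)\<^sup>2 \<partial>PiM I (\<lambda>_. P)) \<le> (\<Sum>i\<in>C. 1)"
    by (rule sum_mono)
  then show "(\<integral>\<omega>. ((\<Sum>i\<in>C. X i \<omega>) - (\<Sum>i\<in>C. \<integral>\<omega>. X i \<omega> \<partial>PiM I (\<lambda>_. P)))\<^sup>2 \<partial>PiM I (\<lambda>_. P)) \<le> real (card C)"
    using PI.indep_vars_sum_variance_le(2)[OF C(1) ind sq] by simp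
qed

section \<open>Truncated second moments and the expected error\<close>

text \<open>The one quantity to which all order statistic terms reduce: it bounds the second moment
  of the excess over \<open>x\<close> and, divided by \<open>x\<close>, its mean.\<close>

definition tail_second_moment :: "real measure \<Rightarrow> real \<Rightarrow> real" where
  "tail_second_moment P x = (\<integral>y. (if \<bar>y\<bar> > x then y\<^sup>2 else 0) \<partial>P)"

lemma tail_second_moment_bounds:
  assumes P: "std_noise P" and x: "x > 0"
  shows "integrable P (\<lambda>y. if \<bar>y\<bar> > x then y\<^sup>2 else 0)"
    and "integrable P (\<lambda>y. (max 0 (\<bar>y\<bar> - x))\<^sup>2)"
    and "(\<integral>y. (max 0 (\<bar>y\<bar> - x))\<^sup>2 \<partial>P) \<le> tail_second_moment P x"
    and "(\<integral>y. max 0 (\<bar>y\<bar> - x) \<partial>P) \<le> tail_second_moment P x / x"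
proof -
  have P': "prob_space P" "sets P = sets borel" "integrable P (\<lambda>y. y\<^sup>2)" "integrable P (\<lambda>y. y)"
    using P by (auto simp: std_noise_def)
  interpret P: prob_space P by fact
  note [measurable_cong] = P'(2)
  show i1: "integrable P (\<lambda>y. if \<bar>y\<bar> > x then y\<^sup>2 else 0)"
    by (rule Bochner_Integration.integrable_bound[OF P'(3)]) (auto simp: P'(2))
  have sq: "(max 0 (\<bar>y\<bar> - x))\<^sup>2 \<le> (if \<bar>y\<bar> > x then y\<^sup>2 else 0)" for y :: real
    using x by (auto simp: abs_le_square_iff[symmetric])
  show i2: "integrable P (\<lambda>y. (max 0 (\<bar>y\<bar> - x))\<^sup>2)"
    by (rule Bochner_Integration.integrable_bound[OF i1]) (use sq in auto)
  show "(\<integral>y. (max 0 (\<bar>y\<bar> - x))\<^sup>2 \<partial>P) \<le> tail_second_moment P x"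
    unfolding tail_second_moment_def by (rule integral_mono[OF i2 i1 sq])
  have i3: "integrable P (\<lambda>y. max 0 (\<bar>y\<bar> - x))"
    using P'(4) by (intro integrable_max) simp_all
  have "(\<integral>y. max 0 (\<bar>y\<bar> - x) \<partial>P) \<le> (\<integral>y. (if \<bar>y\<bar> > x then y\<^sup>2 else 0) / x \<partial>P)"
  proof (rule integral_mono[OF i3])
    fix y :: real
    have "(\<bar>y\<bar> - x) * x \<le> y\<^sup>2" if "\<bar>y\<bar> > x"
    proof -
      have "(\<bar>y\<bar> - x) * x \<le> \<bar>y\<bar> * \<bar>y\<bar>" using that x by (intro mult_mono) auto
      then show ?thesis by (simp add: power2_eq_square)
    qed
    then show "max 0 (\<bar>y\<bar> - x) \<le> (if \<bar>y\<bar> > x then y\<^sup>2 else 0) / x"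
      using x by (auto simp: field_simps)
  qed (use i1 in simp)
  then show "(\<integral>y. max 0 (\<bar>y\<bar> - x) \<partial>P) \<le> tail_second_moment P x / x"
    by (simp add: tail_second_moment_def)
qed

text \<open>The three conditions on the weight profile have separate tasks. \<open>tail\<close>
  keeps the mean of the sum of excesses over \<open>K * \<mu> j\<close> below \<open>j\<close> times
  that level, as \<open>order_statistic_excess\<close> asks of \<open>e\<close>.
  \<open>tail_sum\<close> adds up the variances of these sums with the weights
  \<open>1 / j^2\<close>. \<open>\<mu>_sum\<close> controls the squared weights on the head. All are
  measured against \<open>s * (\<mu> s)^2\<close>, which is \<open>d\<close> times the target
  rate.\<close>

lemma expect_sigma_hat2_error_le:
  fixes P :: "real measure" and \<mu> \<theta> :: "nat \<Rightarrow> real" and n0 :: nat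
  assumes P: "std_noise P" and x4: "integrable P (\<lambda>x. x ^ 4)" "(\<integral>x. x ^ 4 \<partial>P) \<le> \<kappa>"
    and n0: "1 \<le> n0" "256 * \<kappa> \<le> real n0" and md: "m * n0 \<le> d" "d \<le> 2 * n0 * m"
    and blocks: "mom_blocks d m B" and supp: "card {i\<in>{..<d}. \<theta> i \<noteq> 0} \<le> s"
    and s: "1 \<le> s" "4 * s < m" and \<sigma>: "\<sigma> > 0" and K: "K > 0" and A: "A \<ge> 0"
    and \<mu>1: "\<And>j. 1 \<le> j \<Longrightarrow> j \<le> d \<Longrightarrow> \<mu> j \<ge> 1"
    and anti: "\<And>i j. 1 \<le> i \<Longrightarrow> i \<le> j \<Longrightarrow> j \<le> d \<Longrightarrow> \<mu> j \<le> \<mu> i"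
    and tail: "\<And>j. 1 \<le> j \<Longrightarrow> j \<le> d \<Longrightarrow>
      real d * tail_second_moment P (K * \<mu> j) \<le> real j * (K * \<mu> j)\<^sup>2"
    and tail_sum: "(\<Sum>j=1..d. real d / (real j)\<^sup>2 * tail_second_moment P (K * \<mu> j)) \<le> A * (real s * (\<mu> s)\<^sup>2)"
    and \<mu>_sum: "(\<Sum>j=1..s. (\<mu> j)\<^sup>2) \<le> A * (real s * (\<mu> s)\<^sup>2)"
  shows "expect_Y d P \<sigma> \<theta> (\<lambda>Y. \<bar>sigma_hat2 (\<lambda>j. 24 * K * \<mu> j) d m B Y - \<sigma>\<^sup>2\<bar>)
    \<le> ennreal ((9 * (\<kappa> + 1) + 2176 * real n0 + 9792 * K\<^sup>2 * (A + 1) + 48 * K\<^sup>2 + 32 * A) * \<sigma>\<^sup>2 *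
         max (1 / sqrt (real d)) (real s * (\<mu> s)\<^sup>2 / real d))"
proof -
  define Q where "Q = PiM {..<d} (\<lambda>_. P)"
  define C where "C = {i\<in>{..<m}. \<forall>j\<in>B i. \<theta> j = 0}"
  define M where "M = (\<lambda>i \<xi>::nat \<Rightarrow> real. (\<Sum>j\<in>B i. (\<xi> j)\<^sup>2) / real (card (B i)))"
  define G where "G = (\<lambda>i \<xi>. max 0 (1 - M i \<xi>))"
  define b where "b = (\<Sum>i\<in>C. \<integral>\<xi>. G i \<xi> \<partial>Q)"
  define x where "x = (\<lambda>j. K * \<mu> j)"
  define H where "H = tail_second_moment P"
  define e where "e = (\<lambda>r. real d * (\<integral>y. max 0 (\<bar>y\<bar> - x (Suc r)) \<partial>P))"
  define \<Lambda> where "\<Lambda> = (\<Sum>r<2 * s. (24 * K * \<mu> (Suc r))\<^sup>2)"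
  define \<rho> where "\<rho> = real s * (\<mu> s)\<^sup>2"
  have P': "prob_space P" "sets P = sets borel" "integrable P (\<lambda>y. y\<^sup>2)" "(\<integral>y. y\<^sup>2 \<partial>P) = 1"
    using P by (auto simp: std_noise_def)
  interpret P: prob_space P by fact
  interpret Q: prob_space Q unfolding Q_def by (intro prob_space_PiM P')
  have m: "m > 0" using s by simp
  have mle: "m \<le> d" using mult_le_mono2[OF n0(1), of m] md(1) by linarith
  have d: "d > 0" using m mle by simp
  have sd: "2 * s \<le> d" using s mle by simp
  have \<kappa>: "\<kappa> \<ge> 0"
    using x4(2) by (rule order_trans[rotated]) simp
  have xpos: "x j > 0" if "1 \<le> j" "j \<le> d" for j
    using \<mu>1[OF that] K by (simp add: x_def)
  have finC: "finite C" by (simp add: C_def)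
  have cardC: "card C \<le> m"
  proof -
    have "card C \<le> card {..<m}" by (rule card_mono) (auto simp: C_def)
    then show ?thesis by simp
  qed
  have Bsub: "B i \<subseteq> {..<d}" if "i \<in> C" for i
    using that blocks by (auto simp: C_def mom_blocks_def)
  have Bcard: "n0 \<le> card (B i)" if "i \<in> C" for i
  proof -
    have "n0 \<le> d div m"
      using md(1) m by (simp add: less_eq_div_iff_mult_less_eq mult.commute)
    also have "\<dots> \<le> card (B i)"
      using that blocks by (auto simp: C_def mom_blocks_def)
    finally show ?thesis .
  qed
  have Bdisj: "disjoint_family_on B C"
    using blocks by (auto simp: C_def mom_blocks_def disjoint_family_on_def)

  define T1 where "T1 = (\<lambda>\<xi>::nat \<Rightarrow> real. ((\<Sum>i<d. (\<xi> i)\<^sup>2) - real d)\<^sup>2)"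
  define T2 where "T2 = (\<lambda>\<xi>. ((\<Sum>i\<in>C. G i \<xi>) - b)\<^sup>2)"
  define T3 where "T3 = (\<lambda>\<xi>::nat \<Rightarrow> real. \<Sum>i<d. if \<bar>\<xi> i\<bar> > x s then (\<xi> i)\<^sup>2 else 0)"
  define T4 where "T4 = (\<lambda>\<xi>. \<Sum>i\<in>C. M i \<xi>)"
  define T5 where "T5 = (\<lambda>r \<xi>::nat \<Rightarrow> real. ((\<Sum>i<d. max 0 (\<bar>\<xi> i\<bar> - x (Suc r))) - e r)\<^sup>2)"

  have T1: "integrable Q T1" "(\<integral>\<xi>. T1 \<xi> \<partial>Q) \<le> real d * \<kappa>"
  proof -
    have i4: "integrable P (\<lambda>y::real. (y\<^sup>2)\<^sup>2)" using x4(1) by (simp flip: power_mult)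
    note v = iid_sum_variance_le[OF P'(1,2) _ i4 finite_lessThan order_refl, of d]
    show "integrable Q T1"
      using v(1) by (simp add: T1_def Q_def P')
    have "(\<integral>\<xi>. T1 \<xi> \<partial>Q) \<le> real d * (\<integral>y. y ^ 4 \<partial>P)"
      using v(2) by (simp add: T1_def Q_def P' flip: power_mult)
    also have "\<dots> \<le> real d * \<kappa>" using x4(2) by (intro mult_left_mono) auto
    finally show "(\<integral>\<xi>. T1 \<xi> \<partial>Q) \<le> real d * \<kappa>" .
  qed
  have b: "b \<le> real m / 16"
  proof -
    have "b \<le> (\<Sum>i\<in>C. 1 / 16)"
      unfolding b_def G_def M_def Q_def
      by (intro sum_mono block_deficiency_mean_le(2)[OF P x4 finite_lessThan Bsub Bcard n0])
    then show ?thesis using cardC by simp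
  qed
  have T2: "integrable Q T2" "(\<integral>\<xi>. T2 \<xi> \<partial>Q) \<le> real m"
  proof -
    note v = block_deficiency_variance_le[OF P'(1,2) finC Bsub Bdisj]
    show "integrable Q T2"
      using v(1) by (simp add: T2_def Q_def b_def G_def M_def)
    have "(\<integral>\<xi>. T2 \<xi> \<partial>Q) \<le> real (card C)"
      using v(2) by (simp add: T2_def Q_def b_def G_def M_def)
    then show "(\<integral>\<xi>. T2 \<xi> \<partial>Q) \<le> real m" using cardC by simp
  qed
  have T3: "integrable Q T3" "(\<integral>\<xi>. T3 \<xi> \<partial>Q) = real d * H (x s)"
  proof -
    note i = tail_second_moment_bounds(1)[OF P xpos, of s]
    have s': "1 \<le> s" "s \<le> d" using s sd by auto
    have int: "integrable Q (\<lambda>\<xi>. if \<bar>\<xi> i\<bar> > x s then (\<xi> i)\<^sup>2 else 0)" if "i \<in> {..<d}" for i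
      using integral_PiM_coordinate(1)[OF P'(1,2) that i[OF s']] by (simp add: Q_def)
    then show "integrable Q T3"
      unfolding T3_def by (rule Bochner_Integration.integrable_sum)
    have "(\<integral>\<xi>. T3 \<xi> \<partial>Q) = (\<Sum>i<d. \<integral>\<xi>. (if \<bar>\<xi> i\<bar> > x s then (\<xi> i)\<^sup>2 else 0) \<partial>Q)"
      unfolding T3_def by (intro Bochner_Integration.integral_sum int)
    also have "\<dots> = (\<Sum>i<d. H (x s))"
      using integral_PiM_coordinate(2)[OF P'(1,2) _ i[OF s'], where I = "{..<d}"]
      by (intro sum.cong refl) (auto simp: Q_def H_def tail_second_moment_def)
    finally show "(\<integral>\<xi>. T3 \<xi> \<partial>Q) = real d * H (x s)" by simp
  qed
  have T4: "integrable Q T4" "(\<integral>\<xi>. T4 \<xi> \<partial>Q) \<le> real m"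
  proof -
    have int: "integrable Q (\<lambda>\<xi>. (\<xi> j)\<^sup>2)" "(\<integral>\<xi>. (\<xi> j)\<^sup>2 \<partial>Q) = 1" if "j < d" for j
      using integral_PiM_coordinate[OF P'(1,2) _ P'(3), of j "{..<d}"] that P'(4) by (simp_all add: Q_def)
    have Mi: "integrable Q (M i)" "(\<integral>\<xi>. M i \<xi> \<partial>Q) = 1" if "i \<in> C" for i
    proof -
      show "integrable Q (M i)"
        using int Bsub[OF that] unfolding M_def
        by (intro integrable_divide Bochner_Integration.integrable_sum) auto
      have "(\<integral>\<xi>. M i \<xi> \<partial>Q) = (\<Sum>j\<in>B i. \<integral>\<xi>. (\<xi> j)\<^sup>2 \<partial>Q) / real (card (B i))"
        using int Bsub[OF that] unfolding M_def
        by (subst integral_divide_zero, subst Bochner_Integration.integral_sum) auto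
      also have "(\<Sum>j\<in>B i. \<integral>\<xi>. (\<xi> j)\<^sup>2 \<partial>Q) = (\<Sum>j\<in>B i. 1)"
        using int(2) Bsub[OF that] by (intro sum.cong refl) auto
      finally show "(\<integral>\<xi>. M i \<xi> \<partial>Q) = 1"
        using Bcard[OF that] n0 by simp
    qed
    show "integrable Q T4"
      unfolding T4_def by (intro Bochner_Integration.integrable_sum Mi)
    have "(\<integral>\<xi>. T4 \<xi> \<partial>Q) = (\<Sum>i\<in>C. \<integral>\<xi>. M i \<xi> \<partial>Q)"
      unfolding T4_def by (intro Bochner_Integration.integral_sum Mi)
    then show "(\<integral>\<xi>. T4 \<xi> \<partial>Q) \<le> real m"
      using Mi cardC by simp
  qed
  have T5: "integrable Q (T5 r)" "(\<integral>\<xi>. T5 r \<xi> \<partial>Q) \<le> real d * H (x (Suc r))" if "r < d" for r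
  proof -
    have xr: "x (Suc r) > 0" using that by (intro xpos) auto
    note t = tail_second_moment_bounds[OF P xr]
    note v = iid_sum_variance_le[OF P'(1,2) _ t(2) finite_lessThan order_refl, of d]
    show "integrable Q (T5 r)"
      using v(1) by (simp add: T5_def Q_def e_def)
    have "(\<integral>\<xi>. T5 r \<xi> \<partial>Q) \<le> real d * (\<integral>y. (max 0 (\<bar>y\<bar> - x (Suc r)))\<^sup>2 \<partial>P)"
      using v(2) by (simp add: T5_def Q_def e_def)
    also have "\<dots> \<le> real d * H (x (Suc r))"
      using t(3) by (intro mult_left_mono) (auto simp: H_def)
    finally show "(\<integral>\<xi>. T5 r \<xi> \<partial>Q) \<le> real d * H (x (Suc r))" .
  qed
  have e: "e r \<le> real (Suc r) * (K * \<mu> (Suc r))" if "r < d" for r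
  proof -
    have xr: "x (Suc r) > 0" using that by (intro xpos) auto
    have "e r \<le> real d * (H (x (Suc r)) / x (Suc r))"
      unfolding e_def H_def by (intro mult_left_mono tail_second_moment_bounds(4)[OF P xr]) simp
    also have "\<dots> \<le> real (Suc r) * (x (Suc r))\<^sup>2 / x (Suc r)"
      using tail[of "Suc r"] that xr unfolding H_def x_def times_divide_eq_right
      by (intro divide_right_mono) auto
    also have "\<dots> = real (Suc r) * x (Suc r)"
      using xr by (simp add: power2_eq_square)
    finally show ?thesis by (simp add: x_def)
  qed

  \<comment> \<open>The pointwise bound with the absolute deviation replaced by a quadratic
    majorant. It is affine in \<open>T1\<close> to \<open>T5\<close>, since \<open>\<Lambda>\<close>
    is deterministic, so its mean is obtained by inserting theirs.\<close>
  define g where "g = (\<lambda>\<xi>. 18 * (T1 \<xi> / (real d * sqrt (real d)) / 2 + 1 / sqrt (real d) / 2)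
     + 17 * (64 / (real m)\<^sup>2 * T2 \<xi>) + \<Lambda> / real d
     + 2 / real d * (8 * (2 * real s * (x s)\<^sup>2 + T3 \<xi>) + 2 * (4 / real m * T4 \<xi>) * \<Lambda>
        + 4 * (\<Sum>r=2 * s..<d. 4 / (real (Suc r))\<^sup>2 * T5 r \<xi>)))"
  have \<Lambda>0: "\<Lambda> \<ge> 0"
    by (simp add: \<Lambda>_def sum_nonneg)
  have dom: "\<bar>sigma_hat2 (\<lambda>j. 24 * K * \<mu> j) d m B (\<lambda>i. \<theta> i + \<sigma> * \<xi> i) - \<sigma>\<^sup>2\<bar> \<le> \<sigma>\<^sup>2 * g \<xi>" for \<xi>
  proof -
    define y where "y = (\<Sum>i<d. (\<xi> i)\<^sup>2) / real d - 1"
    \<comment> \<open>AM-GM weighted by \<open>sqrt (real d)\<close>, the inverse of the typical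
      size of \<open>y\<close>, so that both terms have mean of order
      \<open>1 / sqrt (real d)\<close>.\<close>
    have "\<bar>y\<bar> \<le> T1 \<xi> / (real d * sqrt (real d)) / 2 + 1 / sqrt (real d) / 2"
    proof -
      have "T1 \<xi> = (real d)\<^sup>2 * y\<^sup>2"
        using d by (simp add: T1_def y_def field_simps power2_eq_square)
      then have "T1 \<xi> / (real d * sqrt (real d)) = sqrt (real d) * y\<^sup>2"
        using d real_sqrt_pow2[of "real d"] by (simp add: field_simps power2_eq_square)
      moreover have "0 \<le> (sqrt (real d) * \<bar>y\<bar> - 1)\<^sup>2 / sqrt (real d)"
        by simp
      moreover have "(sqrt (real d) * \<bar>y\<bar> - 1)\<^sup>2 / sqrt (real d) = sqrt (real d) * y\<^sup>2 - 2 * \<bar>y\<bar> + 1 / sqrt (real d)"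
        using d by (simp add: power2_diff field_simps power2_eq_square)
      ultimately show ?thesis by simp
    qed
    then have yb: "18 * \<bar>y\<bar> \<le> 18 * (T1 \<xi> / (real d * sqrt (real d)) / 2 + 1 / sqrt (real d) / 2)"
      by (rule mult_left_mono) simp
    have "\<bar>sigma_hat2 (\<lambda>j. 24 * K * \<mu> j) d m B (\<lambda>i. \<theta> i + \<sigma> * \<xi> i) - \<sigma>\<^sup>2\<bar> \<le> \<sigma>\<^sup>2 *
      (18 * \<bar>y\<bar> + 17 * (64 / (real m)\<^sup>2 * T2 \<xi>) + \<Lambda> / real d
       + 2 / real d * (8 * (2 * real s * (x s)\<^sup>2 + T3 \<xi>) + 2 * (4 / real m * T4 \<xi>) * \<Lambda>
        + 4 * (\<Sum>r=2 * s..<d. 4 / (real (Suc r))\<^sup>2 * T5 r \<xi>)))"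
      unfolding y_def T2_def T3_def T4_def T5_def x_def C_def M_def G_def \<Lambda>_def
      by (rule sigma_hat2_error_le[OF blocks supp s mle \<sigma> K \<mu>1 anti e b])
    also have "\<dots> \<le> \<sigma>\<^sup>2 * g \<xi>"
      unfolding g_def by (intro mult_left_mono[OF add_right_mono[OF add_right_mono[OF add_right_mono[OF yb]]]]) simp
    finally show ?thesis .
  qed
  define Eg where "Eg = 18 * ((\<integral>\<xi>. T1 \<xi> \<partial>Q) / (real d * sqrt (real d)) / 2 + 1 / sqrt (real d) / 2)
     + 17 * (64 / (real m)\<^sup>2 * (\<integral>\<xi>. T2 \<xi> \<partial>Q)) + \<Lambda> / real d
     + 2 / real d * (8 * (2 * real s * (x s)\<^sup>2 + (\<integral>\<xi>. T3 \<xi> \<partial>Q)) + 2 * (4 / real m * (\<integral>\<xi>. T4 \<xi> \<partial>Q)) * \<Lambda>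
        + 4 * (\<Sum>r=2 * s..<d. 4 / (real (Suc r))\<^sup>2 * (\<integral>\<xi>. T5 r \<xi> \<partial>Q)))"
  have const: "has_bochner_integral Q (\<lambda>_. c) c" for c :: real
    by (simp add: has_bochner_integral_iff Q.prob_space)
  have g: "has_bochner_integral Q g Eg"
    unfolding g_def Eg_def
    by (intro has_bochner_integral_add has_bochner_integral_mult_right has_bochner_integral_mult_left
        has_bochner_integral_divide_zero has_bochner_integral_sum const has_bochner_integral_integrable T1 T2 T3 T4 T5) auto
  define R where "R = max (1 / sqrt (real d)) (\<rho> / real d)"
  have R: "1 / sqrt (real d) \<le> R" "\<rho> / real d \<le> R"
    by (simp_all add: R_def)
  have sqrt_d: "sqrt (real d) \<le> real d"
    using d by (intro real_le_lsqrt) (auto simp: power2_eq_square)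
  have scale: "a * \<rho> / real d \<le> a * R" if "a \<ge> 0" for a
    using mult_left_mono[OF R(2) that] by simp
  have scale_div: "y / real d \<le> a * R" if "y \<le> a * \<rho>" "a \<ge> 0" for y a
    using divide_right_mono[OF that(1), of "real d"] scale[OF that(2)] by simp
  have a1: "(\<integral>\<xi>. T1 \<xi> \<partial>Q) / (real d * sqrt (real d)) / 2 + 1 / sqrt (real d) / 2 \<le> (\<kappa> + 1) / 2 * R"
  proof -
    have "(\<integral>\<xi>. T1 \<xi> \<partial>Q) / (real d * sqrt (real d)) \<le> real d * \<kappa> / (real d * sqrt (real d))"
      by (intro divide_right_mono T1) simp
    also have "\<dots> = \<kappa> * (1 / sqrt (real d))"
      using d by simp
    also have "\<dots> \<le> \<kappa> * R" by (intro mult_left_mono R \<kappa>)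
    finally show ?thesis using R(1) by (simp add: field_simps)
  qed
  have a2: "64 / (real m)\<^sup>2 * (\<integral>\<xi>. T2 \<xi> \<partial>Q) \<le> 128 * real n0 * R"
  proof -
    have "64 / (real m)\<^sup>2 * (\<integral>\<xi>. T2 \<xi> \<partial>Q) \<le> 64 / (real m)\<^sup>2 * real m"
      by (intro mult_left_mono T2) simp
    also have "\<dots> = 64 / real m" using m by (simp add: power2_eq_square)
    \<comment> \<open>The number of blocks is comparable to \<open>d / n0\<close>, so the low-scale
      event costs only \<open>O(1 / d)\<close>; this is weakened to the parametric rate
      afterwards.\<close>
    also have "\<dots> \<le> 128 * real n0 / real d"
    proof -
      have "real d \<le> 2 * real n0 * real m"
        using md(2) by (metis of_nat_le_iff of_nat_mult of_nat_numeral)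
      then show ?thesis using m d by (simp add: field_simps)
    qed
    also have "\<dots> \<le> 128 * real n0 / sqrt (real d)"
      using sqrt_d d by (intro divide_left_mono) auto
    also have "\<dots> \<le> 128 * real n0 * R"
      using mult_left_mono[OF R(1), of "128 * real n0"] by simp
    finally show ?thesis .
  qed
  have s': "1 \<le> s" "s \<le> d" using s sd by auto
  have \<rho>0: "\<rho> \<ge> 0" by (simp add: \<rho>_def)
  \<comment> \<open>\<open>576 = 24^2\<close>. The first \<open>s\<close> squares are covered by
    \<open>\<mu>_sum\<close>; by monotonicity each of the next \<open>s\<close> is at most
    \<open>(\<mu> s)^2\<close>, which adds one more \<open>\<rho>\<close>.\<close>
  have \<Lambda>: "\<Lambda> \<le> 576 * K\<^sup>2 * (A + 1) * \<rho>"
  proof -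
    have "(\<Sum>r<2 * s. (\<mu> (Suc r))\<^sup>2) = (\<Sum>r<s. (\<mu> (Suc r))\<^sup>2) + (\<Sum>r=s..<2 * s. (\<mu> (Suc r))\<^sup>2)"
      using sum.atLeastLessThan_concat[of 0 s "2 * s" "\<lambda>r. (\<mu> (Suc r))\<^sup>2"] by (simp add: atLeast0LessThan)
    also have "(\<Sum>r<s. (\<mu> (Suc r))\<^sup>2) = (\<Sum>j=1..s. (\<mu> j)\<^sup>2)"
      by (simp add: sum.atLeast1_atMost_eq)
    also have "(\<Sum>r=s..<2 * s. (\<mu> (Suc r))\<^sup>2) \<le> (\<Sum>r=s..<2 * s. (\<mu> s)\<^sup>2)"
    proof (intro sum_mono power_mono)
      fix r assume "r \<in> {s..<2 * s}"
      then show "\<mu> (Suc r) \<le> \<mu> s" "0 \<le> \<mu> (Suc r)"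
        using anti[of s "Suc r"] \<mu>1[of "Suc r"] s sd by auto
    qed
    also have "(\<Sum>r=s..<2 * s. (\<mu> s)\<^sup>2) = \<rho>" by (simp add: \<rho>_def)
    finally have "(\<Sum>r<2 * s. (\<mu> (Suc r))\<^sup>2) \<le> (A + 1) * \<rho>"
      using \<mu>_sum by (simp add: \<rho>_def algebra_simps)
    then have "576 * K\<^sup>2 * (\<Sum>r<2 * s. (\<mu> (Suc r))\<^sup>2) \<le> 576 * K\<^sup>2 * ((A + 1) * \<rho>)"
      by (intro mult_left_mono) simp_all
    then show ?thesis
      by (simp add: \<Lambda>_def power_mult_distrib sum_distrib_left mult.assoc)
  qed
  have a3: "\<Lambda> / real d \<le> 576 * K\<^sup>2 * (A + 1) * R"
    using A by (intro scale_div \<Lambda>) simp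
  have a4: "(2 * real s * (x s)\<^sup>2 + (\<integral>\<xi>. T3 \<xi> \<partial>Q)) / real d \<le> 3 * K\<^sup>2 * R"
  proof (rule scale_div)
    have "real d * H (x s) \<le> K\<^sup>2 * \<rho>"
      using tail[OF s'] by (simp add: H_def x_def \<rho>_def power_mult_distrib algebra_simps)
    moreover have "2 * real s * (x s)\<^sup>2 = 2 * K\<^sup>2 * \<rho>"
      by (simp add: x_def \<rho>_def power_mult_distrib)
    ultimately show "2 * real s * (x s)\<^sup>2 + (\<integral>\<xi>. T3 \<xi> \<partial>Q) \<le> 3 * K\<^sup>2 * \<rho>"
      using T3(2) by simp
  qed simp
  have a5: "(4 / real m * (\<integral>\<xi>. T4 \<xi> \<partial>Q)) * \<Lambda> / real d \<le> 4 * (576 * K\<^sup>2 * (A + 1) * R)"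
  proof -
    have "4 / real m * (\<integral>\<xi>. T4 \<xi> \<partial>Q) \<le> 4 / real m * real m"
      by (intro mult_left_mono T4) simp
    then have "4 / real m * (\<integral>\<xi>. T4 \<xi> \<partial>Q) \<le> 4"
      using m by simp
    from mult_right_mono[OF this, of "\<Lambda> / real d"] show ?thesis
      using \<Lambda>0 a3 by simp
  qed
  have H0: "H y \<ge> 0" for y
    unfolding H_def tail_second_moment_def by (intro Bochner_Integration.integral_nonneg) simp
  have a6: "(\<Sum>r=2 * s..<d. 4 / (real (Suc r))\<^sup>2 * (\<integral>\<xi>. T5 r \<xi> \<partial>Q)) / real d \<le> 4 * A * R"
  proof (rule scale_div)
    have "(\<Sum>r=2 * s..<d. 4 / (real (Suc r))\<^sup>2 * (\<integral>\<xi>. T5 r \<xi> \<partial>Q))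
        \<le> (\<Sum>r=2 * s..<d. 4 / (real (Suc r))\<^sup>2 * (real d * H (x (Suc r))))"
      by (intro sum_mono mult_left_mono T5) auto
    also have "\<dots> \<le> (\<Sum>r<d. 4 / (real (Suc r))\<^sup>2 * (real d * H (x (Suc r))))"
      using H0 by (intro sum_mono2) auto
    also have "\<dots> = (\<Sum>j=1..d. 4 / (real j)\<^sup>2 * (real d * H (x j)))"
      by (simp add: sum.atLeast1_atMost_eq)
    also have "\<dots> = 4 * (\<Sum>j=1..d. real d / (real j)\<^sup>2 * H (x j))"
      by (simp add: sum_distrib_left)
    also have "\<dots> \<le> 4 * A * \<rho>"
      using tail_sum by (simp add: H_def x_def \<rho>_def)
    finally show "(\<Sum>r=2 * s..<d. 4 / (real (Suc r))\<^sup>2 * (\<integral>\<xi>. T5 r \<xi> \<partial>Q)) \<le> 4 * A * \<rho>" .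
  qed (use A in simp)
  have group: "2 / real d * (8 * u + 2 * v * \<Lambda> + 4 * w) = 16 * (u / real d) + 4 * (v * \<Lambda> / real d) + 8 * (w / real d)"
    for u v w :: real
    by (simp add: algebra_simps add_divide_distrib)
  \<comment> \<open>The coefficients of the statement collect here: \<open>9 = 18 / 2\<close>,
    \<open>2176 = 17 * 128\<close>, \<open>9792 = 576 + 16 * 576\<close>, \<open>48 = 16 * 3\<close>
    and \<open>32 = 8 * 4\<close>.\<close>
  have "Eg \<le> 18 * ((\<kappa> + 1) / 2 * R) + 17 * (128 * real n0 * R) + 576 * K\<^sup>2 * (A + 1) * R
      + (16 * (3 * K\<^sup>2 * R) + 4 * (4 * (576 * K\<^sup>2 * (A + 1) * R)) + 8 * (4 * A * R))"
    unfolding Eg_def group by (intro add_mono mult_left_mono a1 a2 a3 a4 a5 a6) simp_all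
  also have "\<dots> = (9 * (\<kappa> + 1) + 2176 * real n0 + 9792 * K\<^sup>2 * (A + 1) + 48 * K\<^sup>2 + 32 * A) * R"
    by (simp add: algebra_simps)
  finally have Eg: "\<sigma>\<^sup>2 * Eg \<le> \<sigma>\<^sup>2 * ((9 * (\<kappa> + 1) + 2176 * real n0 + 9792 * K\<^sup>2 * (A + 1) + 48 * K\<^sup>2 + 32 * A) * R)"
    by (intro mult_left_mono) simp_all
  have "has_bochner_integral Q (\<lambda>\<xi>. \<sigma>\<^sup>2 * g \<xi>) (\<sigma>\<^sup>2 * Eg)"
    by (intro has_bochner_integral_mult_right g)
  moreover have "0 \<le> \<sigma>\<^sup>2 * g \<xi>" for \<xi>
    using dom[of \<xi>] by linarith
  ultimately have "(\<integral>\<^sup>+\<xi>. ennreal (\<sigma>\<^sup>2 * g \<xi>) \<partial>Q) = ennreal (\<sigma>\<^sup>2 * Eg)"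
    by (subst nn_integral_eq_integral) (auto simp: has_bochner_integral_iff)
  moreover have "expect_Y d P \<sigma> \<theta> (\<lambda>Y. \<bar>sigma_hat2 (\<lambda>j. 24 * K * \<mu> j) d m B Y - \<sigma>\<^sup>2\<bar>)
      \<le> (\<integral>\<^sup>+\<xi>. ennreal (\<sigma>\<^sup>2 * g \<xi>) \<partial>Q)"
    unfolding expect_Y_def Q_def by (intro nn_integral_mono ennreal_leI dom)
  ultimately show ?thesis
    using ennreal_leI[OF Eg] by (simp add: R_def \<rho>_def mult_ac)
qed

section \<open>Tails of the noise\<close>

text \<open>Dyadic decomposition of the tail; it keeps the exact exponent, which Markov's inequality
  with a lower moment would lose.\<close>
lemma truncated_moment_le:
  fixes P :: "real measure" and q :: nat and b :: real
  assumes P: "prob_space P" "sets P = sets borel" and x: "x > 0" and D: "D \<ge> 0" and q: "real q < b"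
    and tail: "\<And>t. t \<ge> x \<Longrightarrow> measure P {y. \<bar>y\<bar> > t} \<le> D * t powr (- b)"
  shows "integrable P (\<lambda>y. if \<bar>y\<bar> > x then \<bar>y\<bar> ^ q else 0)"
    and "(\<integral>y. (if \<bar>y\<bar> > x then \<bar>y\<bar> ^ q else 0) \<partial>P)
      \<le> 2 ^ q / (1 - 2 powr (real q - b)) * D * x powr (real q - b)"
proof -
  interpret P: prob_space P by fact
  note [measurable_cong] = P(2)
  define f where "f = (\<lambda>y::real. if \<bar>y\<bar> > x then \<bar>y\<bar> ^ q else 0)"
  define c where "c = (\<lambda>k::nat. (2 ^ Suc k * x) ^ q)"
  define U where "U = (\<lambda>k::nat. {y::real. \<bar>y\<bar> > 2 ^ k * x})"
  define w where "w = 2 powr (real q - b)"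
  define V where "V = 2 ^ q / (1 - w) * D * x powr (real q - b)"
  have w: "0 < w" "w < 1"
    using q powr_less_mono[of "real q - b" 0 2] by (simp_all add: w_def)
  have V0: "V \<ge> 0" using w D by (simp add: V_def)
  have U_meas [measurable]: "U k \<in> sets P" for k
    unfolding U_def by measurable
  have ptw: "ennreal (f y) \<le> (\<Sum>k. ennreal (c k) * indicator (U k) y)" for y
  proof (cases "\<bar>y\<bar> > x")
    case True
    have "\<exists>n. \<bar>y\<bar> / x < 2 ^ n" by (rule real_arch_pow) simp
    then have ex: "\<exists>n. \<bar>y\<bar> \<le> 2 ^ n * x"
      using x by (auto simp: pos_divide_less_eq intro: less_imp_le)
    \<comment> \<open>The least such \<open>n\<close> is positive because \<open>|y| > x\<close>,
      and its predecessor \<open>k\<close> satisfies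
      \<open>2 ^ k * x < |y| \<le> 2 ^ Suc k * x\<close>. This single term of the series already
      dominates \<open>f y\<close>.\<close>
    define n where "n = (LEAST n. \<bar>y\<bar> \<le> 2 ^ n * x)"
    have n: "\<bar>y\<bar> \<le> 2 ^ n * x"
      unfolding n_def by (rule LeastI_ex[OF ex])
    with True have "n \<noteq> 0" by (intro notI) simp
    then obtain k where k: "n = Suc k" by (cases n) auto
    have "\<not> \<bar>y\<bar> \<le> 2 ^ k * x"
      using not_less_Least[of k "\<lambda>n. \<bar>y\<bar> \<le> 2 ^ n * x"] k by (simp add: n_def)
    then have "y \<in> U k" by (simp add: U_def)
    moreover have "f y \<le> c k"
      using n True by (simp add: f_def c_def k power_mono)
    ultimately have "ennreal (f y) \<le> (\<Sum>k\<in>{k}. ennreal (c k) * indicator (U k) y)"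
      by (simp add: ennreal_leI)
    also have "\<dots> \<le> (\<Sum>k. ennreal (c k) * indicator (U k) y)"
      by (rule sum_le_suminf) auto
    finally show ?thesis .
  qed (simp add: f_def)
  \<comment> \<open>The \<open>k\<close>-th dyadic level contributes its upper endpoint to the power
    \<open>q\<close> times the tail at its lower endpoint. The ratio of consecutive bounds is
    \<open>w = 2 powr (q - b) < 1\<close>.\<close>
  have piece: "(\<integral>\<^sup>+y. ennreal (c k) * indicator (U k) y \<partial>P) \<le> ennreal (2 ^ q * D * x powr (real q - b) * w ^ k)" for k
  proof -
    have "(\<integral>\<^sup>+y. ennreal (c k) * indicator (U k) y \<partial>P) = ennreal (c k * measure P (U k))"
      using x by (simp add: nn_integral_cmult_indicator P.emeasure_eq_measure ennreal_mult c_def)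
    also have "c k * measure P (U k) \<le> c k * (D * (2 ^ k * x) powr (- b))"
      unfolding U_def using x by (intro mult_left_mono tail) (auto simp: c_def)
    also have "\<dots> = 2 ^ q * D * x powr (real q - b) * w ^ k"
    proof -
      have "(2 ^ k * x) ^ q * (2 ^ k * x) powr (- b) = (2 ^ k * x) powr (real q - b)"
        using x by (simp add: powr_diff powr_minus powr_realpow field_simps)
      also have "\<dots> = (2 ^ k) powr (real q - b) * x powr (real q - b)"
        using x by (simp add: powr_mult)
      also have "(2 ^ k :: real) powr (real q - b) = w ^ k"
        by (simp add: w_def powr_powr mult.commute flip: powr_realpow)
      finally show ?thesis
        by (simp add: c_def power_mult_distrib mult_ac)
    qed
    finally show ?thesis by (simp add: ennreal_leI)
  qed
  have "(\<integral>\<^sup>+y. ennreal (f y) \<partial>P) \<le> (\<integral>\<^sup>+y. (\<Sum>k. ennreal (c k) * indicator (U k) y) \<partial>P)"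
    by (intro nn_integral_mono ptw)
  also have "\<dots> = (\<Sum>k. \<integral>\<^sup>+y. ennreal (c k) * indicator (U k) y \<partial>P)"
    by (rule nn_integral_suminf) measurable
  also have "\<dots> \<le> (\<Sum>k. ennreal (2 ^ q * D * x powr (real q - b) * w ^ k))"
    by (intro suminf_le piece) auto
  also have "\<dots> = ennreal V"
  proof (rule suminf_ennreal_eq)
    show "0 \<le> 2 ^ q * D * x powr (real q - b) * w ^ k" for k
      using D w by simp
    show "(\<lambda>k. 2 ^ q * D * x powr (real q - b) * w ^ k) sums V"
      using sums_mult[OF geometric_sums[of w], of "2 ^ q * D * x powr (real q - b)"] w
      by (simp add: V_def field_simps)
  qed
  finally have nn: "(\<integral>\<^sup>+y. ennreal (f y) \<partial>P) \<le> ennreal V" .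
  have fm: "f \<in> borel_measurable P" unfolding f_def by measurable
  have f0: "f y \<ge> 0" for y by (simp add: f_def)
  have fi: "integrable P f"
    using fm f0 nn by (intro integrableI_nonneg) (auto intro: le_less_trans)
  then show "integrable P (\<lambda>y. if \<bar>y\<bar> > x then \<bar>y\<bar> ^ q else 0)"
    by (simp add: f_def)
  have "ennreal (\<integral>y. f y \<partial>P) \<le> ennreal V"
    using nn nn_integral_eq_integral[OF fi] f0 by simp
  then show "(\<integral>y. (if \<bar>y\<bar> > x then \<bar>y\<bar> ^ q else 0) \<partial>P)
      \<le> 2 ^ q / (1 - 2 powr (real q - b)) * D * x powr (real q - b)"
    using V0 by (simp add: f_def V_def w_def)
qed

lemma fourth_moment_le:
  assumes P: "std_noise P" and D: "D \<ge> 0" and b: "b > 4"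
    and tail: "\<And>t. t \<ge> 2 \<Longrightarrow> measure P {y. \<bar>y\<bar> > t} \<le> D * t powr (- b)"
  shows "integrable P (\<lambda>y. y ^ 4)"
    and "(\<integral>y. y ^ 4 \<partial>P) \<le> 16 + 16 / (1 - 2 powr (4 - b)) * D * 2 powr (4 - b)"
proof -
  have P': "prob_space P" "sets P = sets borel"
    using P by (auto simp: std_noise_def)
  interpret P: prob_space P by fact
  note [measurable_cong] = P'(2)
  define f where "f = (\<lambda>y::real. if \<bar>y\<bar> > 2 then \<bar>y\<bar> ^ 4 else 0)"
  note m = truncated_moment_le[OF P', of 2 D 4 b, folded f_def]
  have fi: "integrable P f" and fb: "(\<integral>y. f y \<partial>P) \<le> 16 / (1 - 2 powr (4 - b)) * D * 2 powr (4 - b)"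
    using m D b tail by simp_all
  \<comment> \<open>Tail control starts at 2; below that, \<open>y ^ 4\<close> is at most
    \<open>2 ^ 4\<close>.\<close>
  have le: "y ^ 4 \<le> 16 + f y" for y :: real
  proof (cases "\<bar>y\<bar> > 2")
    case False
    then have "\<bar>y\<bar> ^ 4 \<le> 2 ^ 4" by (intro power_mono) auto
    then show ?thesis using False by (simp add: f_def)
  qed (simp add: f_def)
  have i: "integrable P (\<lambda>y. 16 + f y)" using fi by simp
  show i4: "integrable P (\<lambda>y. y ^ 4)"
    by (rule Bochner_Integration.integrable_bound[OF i]) (use order_trans[OF le abs_ge_self] in \<open>auto simp: f_def\<close>)
  have "(\<integral>y. y ^ 4 \<partial>P) \<le> (\<integral>y. 16 + f y \<partial>P)"
    by (rule integral_mono[OF i4 i le])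
  also have "\<dots> = 16 + (\<integral>y. f y \<partial>P)" using fi by (simp add: P.prob_space)
  finally show "(\<integral>y. y ^ 4 \<partial>P) \<le> 16 + 16 / (1 - 2 powr (4 - b)) * D * 2 powr (4 - b)"
    using fb by simp
qed

lemma tail_second_moment_le:
  assumes P: "std_noise P" and x: "x > 0" and D: "D \<ge> 0" and b: "b > 2"
    and tail: "\<And>t. t \<ge> x \<Longrightarrow> measure P {y. \<bar>y\<bar> > t} \<le> D * t powr (- b)"
  shows "tail_second_moment P x \<le> 4 / (1 - 2 powr (2 - b)) * D * x powr (2 - b)"
proof -
  have "(\<lambda>y::real. if \<bar>y\<bar> > x then \<bar>y\<bar> ^ 2 else 0) = (\<lambda>y. if \<bar>y\<bar> > x then y\<^sup>2 else 0)"
    by auto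
  then show ?thesis
    using truncated_moment_le(2)[of P x D 2 b] assms
    by (simp add: std_noise_def tail_second_moment_def)
qed

section \<open>Bounds uniform over a class of noise distributions\<close>

text \<open>Interface to the two tail classes: each has to supply a fourth moment bound and a
  profile \<open>\<mu>\<close> satisfying the growth and tail conditions. The witnesses
  \<open>24 * K\<close>, \<open>C\<close> and \<open>1 / n0\<close> are fixed before
  \<open>s\<close>, \<open>d\<close> and \<open>P\<close>, which gives the required
  uniformity.\<close>

lemma uniform_sigma_hat2_error_le:
  fixes \<P> :: "real measure \<Rightarrow> bool" and \<mu> :: "nat \<Rightarrow> nat \<Rightarrow> real" and \<kappa> K A :: real
  assumes cls: "\<And>P. \<P> P \<Longrightarrow> std_noise P \<and> integrable P (\<lambda>x. x ^ 4) \<and> (\<integral>x. x ^ 4 \<partial>P) \<le> \<kappa>"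
    and K: "K > 0" and A: "A \<ge> 0" and \<kappa>: "\<kappa> \<ge> 0"
    and \<mu>1: "\<And>d j. 1 \<le> j \<Longrightarrow> j \<le> d \<Longrightarrow> \<mu> d j \<ge> 1"
    and anti: "\<And>d i j. 1 \<le> i \<Longrightarrow> i \<le> j \<Longrightarrow> j \<le> d \<Longrightarrow> \<mu> d j \<le> \<mu> d i"
    and tail: "\<And>P d j. \<P> P \<Longrightarrow> 1 \<le> j \<Longrightarrow> j \<le> d \<Longrightarrow>
      real d * tail_second_moment P (K * \<mu> d j) \<le> real j * (K * \<mu> d j)\<^sup>2"
    and tail_sum: "\<And>P d s. \<P> P \<Longrightarrow> 1 \<le> s \<Longrightarrow> s \<le> d \<Longrightarrow>
      (\<Sum>j=1..d. real d / (real j)\<^sup>2 * tail_second_moment P (K * \<mu> d j)) \<le> A * (real s * (\<mu> d s)\<^sup>2)"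
    and \<mu>_sum: "\<And>d s. 1 \<le> s \<Longrightarrow> s \<le> d \<Longrightarrow> (\<Sum>j=1..s. (\<mu> d j)\<^sup>2) \<le> A * (real s * (\<mu> d s)\<^sup>2)"
  shows "\<exists>c C \<gamma>. c > 0 \<and> C > 0 \<and> 0 < \<gamma> \<and> \<gamma> \<le> 1/2 \<and>
        (\<forall>(s::nat) (d::nat) B P \<sigma> \<theta>.
           1 \<le> s \<and> real s < real_of_int \<lfloor>\<gamma> * real d\<rfloor> / 4 \<and>
           mom_blocks d (nat \<lfloor>\<gamma> * real d\<rfloor>) B \<and>
           \<P> P \<and> \<sigma> > 0 \<and> card {i\<in>{..<d}. \<theta> i \<noteq> 0} \<le> s \<longrightarrow>
           expect_Y d P \<sigma> \<theta>
             (\<lambda>Y. \<bar>sigma_hat2 (\<lambda>j. c * \<mu> d j) d (nat \<lfloor>\<gamma> * real d\<rfloor>) B Y - \<sigma>\<^sup>2\<bar>)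
           \<le> ennreal (C * \<sigma>\<^sup>2 * max (1 / sqrt (real d)) (real s * (\<mu> d s)\<^sup>2 / real d)))"
proof -
  \<comment> \<open>The 2 yields \<open>\<gamma> \<le> 1 / 2\<close>; the other entry is the block
    size demanded by \<open>block_deficiency_mean_le\<close>.\<close>
  define n0 where "n0 = max 2 (nat \<lceil>256 * \<kappa>\<rceil>)"
  define C where "C = 9 * (\<kappa> + 1) + 2176 * real n0 + 9792 * K\<^sup>2 * (A + 1) + 48 * K\<^sup>2 + 32 * A"
  have n0: "n0 \<ge> 2" "256 * \<kappa> \<le> real n0"
    unfolding n0_def by (auto simp: of_nat_max intro: order_trans[OF real_nat_ceiling_ge])
  have "0 < 9 * (\<kappa> + 1)" using \<kappa> by simp
  moreover have "0 \<le> 2176 * real n0 + 9792 * K\<^sup>2 * (A + 1) + 48 * K\<^sup>2 + 32 * A"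
    using A by (intro add_nonneg_nonneg mult_nonneg_nonneg) auto
  ultimately have C: "C > 0" unfolding C_def by linarith
  show ?thesis
  proof (rule exI[of _ "24 * K"], rule exI[of _ C], rule exI[of _ "1 / real n0"], intro conjI allI impI)
    show "24 * K > 0" "C > 0" "0 < 1 / real n0" "1 / real n0 \<le> 1 / 2"
      using K C n0(1) by (auto simp: field_simps)
    fix s d :: nat and B :: "nat \<Rightarrow> nat set" and P :: "real measure" and \<sigma> :: real and \<theta> :: "nat \<Rightarrow> real"
    assume asm: "1 \<le> s \<and> real s < real_of_int \<lfloor>1 / real n0 * real d\<rfloor> / 4 \<and>
           mom_blocks d (nat \<lfloor>1 / real n0 * real d\<rfloor>) B \<and>
           \<P> P \<and> \<sigma> > 0 \<and> card {i\<in>{..<d}. \<theta> i \<noteq> 0} \<le> s"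
    define m where "m = d div n0"
    have m: "\<lfloor>1 / real n0 * real d\<rfloor> = int m"
      using floor_divide_of_nat_eq[of d n0] by (simp add: m_def)
    have s: "1 \<le> s" "4 * s < m" using asm unfolding m by simp_all
    have md: "m * n0 \<le> d" by (simp add: m_def)
    \<comment> \<open>Since \<open>4 * s < m\<close> with \<open>s \<ge> 1\<close>, rounding
      \<open>d / n0\<close> down loses at most a factor 2.\<close>
    have "d < Suc m * n0"
      unfolding m_def using n0(1) by (metis dividend_less_div_times mult_Suc add.commute mult.commute zero_less_numeral less_le_trans)
    also have "\<dots> \<le> (2 * m) * n0" using s by (intro mult_right_mono) auto
    finally have md2: "d \<le> 2 * n0 * m" by (simp add: mult_ac)
    have "m \<le> m * n0" using n0(1) by simp
    then have sd: "s \<le> d" using s md by linarith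
    have P: "\<P> P" using asm by simp
    show "expect_Y d P \<sigma> \<theta>
             (\<lambda>Y. \<bar>sigma_hat2 (\<lambda>j. 24 * K * \<mu> d j) d (nat \<lfloor>1 / real n0 * real d\<rfloor>) B Y - \<sigma>\<^sup>2\<bar>)
           \<le> ennreal (C * \<sigma>\<^sup>2 * max (1 / sqrt (real d)) (real s * (\<mu> d s)\<^sup>2 / real d))"
      unfolding C_def m nat_int
    proof (rule expect_sigma_hat2_error_le)
      show "mom_blocks d m B" using asm unfolding m by simp
    qed (use cls[OF P] n0 md md2 s asm K A \<mu>1 anti tail[OF P] tail_sum[OF P s(1) sd] \<mu>_sum[OF s(1) sd] in auto)
  qed
qed

lemma sum_inverse_sqrt_le: "(\<Sum>j=1..n. 1 / sqrt (real j)) \<le> 2 * sqrt (real n)"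
proof (induction n)
  case 0
  then show ?case by simp
next
  case (Suc n)
  have p: "sqrt (real (Suc n)) > 0" by simp
  have "(sqrt (real (Suc n)) - sqrt (real n))\<^sup>2 \<ge> 0" by simp
  then have "2 * sqrt (real n) * sqrt (real (Suc n)) + 1 \<le> 2 * (sqrt (real (Suc n)))\<^sup>2"
    by (simp add: power2_diff algebra_simps)
  moreover have "2 * b + 1 / a \<le> 2 * a" if "a > 0" "2 * b * a + 1 \<le> 2 * a\<^sup>2" for a b :: real
  proof -
    have "(2 * b + 1 / a) * a \<le> (2 * a) * a"
      using that by (simp add: distrib_right power2_eq_square)
    then show ?thesis using that(1) by simp
  qed
  ultimately have "2 * sqrt (real n) + 1 / sqrt (real (Suc n)) \<le> 2 * sqrt (real (Suc n))"
    using p by blast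
  then show ?case using Suc by simp
qed

text \<open>The exponent \<open>1 / 2\<close> is a convenient one below 1, where the sum over
  \<open>j\<close> is still comparable to its last term times \<open>s\<close>. Both profiles obey
  it: \<open>2 / a < 1 / 2\<close> for polynomial tails, and logarithms grow more slowly than any
  power.\<close>

lemma sum_squares_le_of_growth:
  fixes \<mu> :: "nat \<Rightarrow> real"
  assumes "\<And>j. 1 \<le> j \<Longrightarrow> j \<le> s \<Longrightarrow> (\<mu> j)\<^sup>2 \<le> E * sqrt (real s / real j) * (\<mu> s)\<^sup>2" and E: "E \<ge> 0"
  shows "(\<Sum>j=1..s. (\<mu> j)\<^sup>2) \<le> 2 * E * (real s * (\<mu> s)\<^sup>2)"
proof -
  have "(\<Sum>j=1..s. (\<mu> j)\<^sup>2) \<le> (\<Sum>j=1..s. E * sqrt (real s) * (\<mu> s)\<^sup>2 * (1 / sqrt (real j)))"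
    using assms(1) by (intro sum_mono) (auto simp: real_sqrt_divide mult_ac)
  also have "\<dots> = E * sqrt (real s) * (\<mu> s)\<^sup>2 * (\<Sum>j=1..s. 1 / sqrt (real j))"
    by (simp add: sum_distrib_left)
  also have "\<dots> \<le> E * sqrt (real s) * (\<mu> s)\<^sup>2 * (2 * sqrt (real s))"
    using E by (intro mult_left_mono sum_inverse_sqrt_le) simp
  also have "\<dots> = 2 * E * (real s * (\<mu> s)\<^sup>2)"
    using real_sqrt_mult_self[of "real s"] by (simp add: mult_ac)
  finally show ?thesis .
qed

section \<open>Polynomial tails\<close>

lemma class_P_uniform_bound:
  fixes a \<tau> :: real
  assumes \<tau>: "\<tau> > 0" and a: "a > 4"
  shows "\<exists>c C \<gamma>. c > 0 \<and> C > 0 \<and> 0 < \<gamma> \<and> \<gamma> \<le> 1/2 \<and>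
        (\<forall>(s::nat) (d::nat) B P \<sigma> \<theta>.
           1 \<le> s \<and> real s < real_of_int \<lfloor>\<gamma> * real d\<rfloor> / 4 \<and>
           mom_blocks d (nat \<lfloor>\<gamma> * real d\<rfloor>) B \<and>
           class_P a \<tau> P \<and> \<sigma> > 0 \<and> card {i\<in>{..<d}. \<theta> i \<noteq> 0} \<le> s \<longrightarrow>
           expect_Y d P \<sigma> \<theta>
             (\<lambda>Y. \<bar>sigma_hat2 (\<lambda>j. c * (real d / real j) powr (1/a)) d (nat \<lfloor>\<gamma> * real d\<rfloor>) B Y - \<sigma>\<^sup>2\<bar>)
           \<le> ennreal (C * \<sigma>\<^sup>2 * max (1 / sqrt (real d)) (real s * ((real d / real s) powr (1/a))\<^sup>2 / real d)))"
proof -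
  define D where "D = \<tau> powr a"
  define c2 where "c2 = 4 / (1 - 2 powr (2 - a))"
  \<comment> \<open>\<open>K powr a \<ge> c2 * D\<close> swallows the constants of
    \<open>tail_second_moment_le\<close>, and \<open>K \<ge> 2\<close> keeps every level
    \<open>K * \<mu> d j\<close> in the range where the class controls the tail.\<close>
  define K where "K = max 2 ((c2 * D) powr (1 / a))"
  define Z where "Z = (\<Sum>j. real j powr (- 1 - 2 / a))"
  define \<kappa> where "\<kappa> = 16 + 16 / (1 - 2 powr (4 - a)) * D * 2 powr (4 - a)"
  define \<mu> where "\<mu> = (\<lambda>d j. (real d / real j) powr (1 / a))"
  have D: "D > 0" using \<tau> by (simp add: D_def)
  have K: "K \<ge> 2" by (simp add: K_def)
  have c2: "c2 > 0"
    using powr_less_mono[of "2 - a" 0 2] a by (simp add: c2_def)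
  have \<kappa>: "\<kappa> \<ge> 0"
    using powr_less_mono[of "4 - a" 0 2] a D by (auto simp: \<kappa>_def intro!: add_nonneg_nonneg mult_nonneg_nonneg)
  have KD: "c2 * D \<le> K powr a"
  proof -
    have "c2 * D = ((c2 * D) powr (1 / a)) powr a"
      using c2 D a by (simp add: powr_powr)
    also have "\<dots> \<le> K powr a"
      using a by (intro powr_mono2) (auto simp: K_def)
    finally show ?thesis .
  qed
  have summ: "summable (\<lambda>j. real j powr (- 1 - 2 / a))"
    using a by (simp add: summable_real_powr_iff)
  have Z: "Z \<ge> 0" unfolding Z_def by (intro suminf_nonneg summ) simp
  have tail: "measure P {y. \<bar>y\<bar> > t} \<le> D * t powr (- a)" if "class_P a \<tau> P" "t \<ge> 2" for P t
  proof -
    have "measure P {y. \<bar>y\<bar> > t} \<le> (\<tau> / t) powr a"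
      using that by (auto simp: class_P_def)
    also have "\<dots> = D * t powr (- a)"
      using that \<tau> by (simp add: D_def powr_divide powr_minus_divide)
    finally show ?thesis .
  qed
  have \<mu>1: "\<mu> d j \<ge> 1" if "1 \<le> j" "j \<le> d" for d j
    using that a by (simp add: \<mu>_def ge_one_powr_ge_zero)
  have \<mu>_sq: "(\<mu> d j)\<^sup>2 = (real d / real j) powr (2 / a)" for d j
    by (simp add: \<mu>_def power2_eq_square flip: powr_add)
  \<comment> \<open>The profile is the quantile scale of the class:
    \<open>\<mu> d j powr (- a) = j / d\<close>, and this is the factor gained over the squared
    level.\<close>
  have H: "tail_second_moment P (K * \<mu> d j) \<le> K\<^sup>2 * (\<mu> d j)\<^sup>2 * (real j / real d)"
    if P: "class_P a \<tau> P" and j: "1 \<le> j" "j \<le> d" for P d j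
  proof -
    define x where "x = K * \<mu> d j"
    have x: "x \<ge> 2" using mult_mono[OF K \<mu>1[OF j]] K by (simp add: x_def)
    have dj: "real d / real j > 0" using j by simp
    have "tail_second_moment P x \<le> c2 * D * x powr (2 - a)"
      unfolding c2_def using P a D x by (intro tail_second_moment_le tail) (auto simp: class_P_def)
    also have "\<dots> \<le> K powr a * x powr (2 - a)"
      using KD by (intro mult_right_mono) auto
    also have "\<dots> = K powr a * (K powr (2 - a) * \<mu> d j powr (2 - a))"
      using K \<mu>1[OF j] by (simp add: x_def powr_mult)
    also have "\<dots> = K powr 2 * \<mu> d j powr (2 - a)"
      by (simp add: mult.assoc[symmetric] flip: powr_add)
    also have "\<mu> d j powr (2 - a) = (real d / real j) powr (2 / a - 1)"
      using a by (simp add: \<mu>_def powr_powr diff_divide_distrib)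
    also have "\<dots> = (\<mu> d j)\<^sup>2 * (real j / real d)"
      using dj by (simp add: \<mu>_sq powr_diff)
    finally show ?thesis using K by (simp add: x_def powr_numeral)
  qed
  have "\<exists>c C \<gamma>. c > 0 \<and> C > 0 \<and> 0 < \<gamma> \<and> \<gamma> \<le> 1/2 \<and>
        (\<forall>(s::nat) (d::nat) B P \<sigma> \<theta>.
           1 \<le> s \<and> real s < real_of_int \<lfloor>\<gamma> * real d\<rfloor> / 4 \<and>
           mom_blocks d (nat \<lfloor>\<gamma> * real d\<rfloor>) B \<and>
           class_P a \<tau> P \<and> \<sigma> > 0 \<and> card {i\<in>{..<d}. \<theta> i \<noteq> 0} \<le> s \<longrightarrow>
           expect_Y d P \<sigma> \<theta>
             (\<lambda>Y. \<bar>sigma_hat2 (\<lambda>j. c * \<mu> d j) d (nat \<lfloor>\<gamma> * real d\<rfloor>) B Y - \<sigma>\<^sup>2\<bar>)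
           \<le> ennreal (C * \<sigma>\<^sup>2 * max (1 / sqrt (real d)) (real s * (\<mu> d s)\<^sup>2 / real d)))"
  proof (rule uniform_sigma_hat2_error_le[where \<kappa> = \<kappa> and K = K and A = "max 2 (K\<^sup>2 * Z)"])
    fix P assume P: "class_P a \<tau> P"
    then have n: "std_noise P" by (simp add: class_P_def)
    show "std_noise P \<and> integrable P (\<lambda>x. x ^ 4) \<and> (\<integral>x. x ^ 4 \<partial>P) \<le> \<kappa>"
      using fourth_moment_le[OF n _ a tail[OF P]] n D by (simp add: \<kappa>_def)
    fix d j :: nat assume j: "1 \<le> j" "j \<le> d"
    show "real d * tail_second_moment P (K * \<mu> d j) \<le> real j * (K * \<mu> d j)\<^sup>2"
      using mult_left_mono[OF H[OF P j], of "real d"] j by (simp add: power_mult_distrib mult_ac)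
  next
    fix P and d s :: nat assume P: "class_P a \<tau> P" and s: "1 \<le> s" "s \<le> d"
    have "(\<Sum>j=1..d. real d / (real j)\<^sup>2 * tail_second_moment P (K * \<mu> d j))
        \<le> (\<Sum>j=1..d. K\<^sup>2 * real d powr (2 / a) * real j powr (- 1 - 2 / a))"
    proof (rule sum_mono)
      fix j assume "j \<in> {1..d}"
      then have j: "1 \<le> j" "j \<le> d" by auto
      have "real d / (real j)\<^sup>2 * tail_second_moment P (K * \<mu> d j)
          \<le> real d / (real j)\<^sup>2 * (K\<^sup>2 * (\<mu> d j)\<^sup>2 * (real j / real d))"
        by (intro mult_left_mono H P j) simp
      also have "\<dots> = K\<^sup>2 * (\<mu> d j)\<^sup>2 / real j"
        using j by (simp add: power2_eq_square[of "real j"])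
      also have "\<dots> = K\<^sup>2 * (real d / real j) powr (2 / a) / real j"
        by (simp only: \<mu>_sq)
      also have "\<dots> = K\<^sup>2 * real d powr (2 / a) * real j powr (- 1 - 2 / a)"
        using j by (simp add: powr_divide powr_diff powr_minus_divide)
      finally show "real d / (real j)\<^sup>2 * tail_second_moment P (K * \<mu> d j)
          \<le> K\<^sup>2 * real d powr (2 / a) * real j powr (- 1 - 2 / a)" .
    qed
    also have "\<dots> = K\<^sup>2 * real d powr (2 / a) * (\<Sum>j=1..d. real j powr (- 1 - 2 / a))"
      by (simp add: sum_distrib_left)
    also have "\<dots> \<le> K\<^sup>2 * real d powr (2 / a) * Z"
      unfolding Z_def by (intro mult_left_mono sum_le_suminf summ) auto
    also have "\<dots> = K\<^sup>2 * Z * real d powr (2 / a)" by simp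
    \<comment> \<open>\<open>s * (\<mu> d s)^2\<close> equals \<open>d powr (2 / a)\<close> times
      \<open>s powr (1 - 2 / a)\<close>, and the last factor is at least 1.\<close>
    also have "\<dots> \<le> K\<^sup>2 * Z * (real s * (\<mu> d s)\<^sup>2)"
    proof (rule mult_left_mono)
      have "real s powr (2 / a) \<le> real s powr 1"
        using s a by (intro powr_mono) auto
      then have "real s powr (2 / a) \<le> real s" using s by simp
      then have "1 \<le> real s / real s powr (2 / a)" using s by simp
      from mult_right_mono[OF this, of "real d powr (2 / a)"]
      show "real d powr (2 / a) \<le> real s * (\<mu> d s)\<^sup>2"
        by (simp add: \<mu>_sq powr_divide)
    qed (use Z in simp)
    also have "\<dots> \<le> max 2 (K\<^sup>2 * Z) * (real s * (\<mu> d s)\<^sup>2)"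
      by (intro mult_right_mono) auto
    finally show "(\<Sum>j=1..d. real d / (real j)\<^sup>2 * tail_second_moment P (K * \<mu> d j))
        \<le> max 2 (K\<^sup>2 * Z) * (real s * (\<mu> d s)\<^sup>2)" .
  next
    fix d s :: nat assume s: "1 \<le> s" "s \<le> d"
    have "(\<Sum>j=1..s. (\<mu> d j)\<^sup>2) \<le> 2 * 1 * (real s * (\<mu> d s)\<^sup>2)"
    proof (rule sum_squares_le_of_growth)
      fix j assume j: "1 \<le> j" "j \<le> s"
      have "(\<mu> d j)\<^sup>2 = ((real s / real j) * (real d / real s)) powr (2 / a)"
        using s j by (simp add: \<mu>_sq)
      also have "\<dots> = (real s / real j) powr (2 / a) * (\<mu> d s)\<^sup>2"
        using s j by (subst powr_mult) (simp_all add: \<mu>_sq)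
      also have "\<dots> \<le> (real s / real j) powr (1 / 2) * (\<mu> d s)\<^sup>2"
        using s j a by (intro mult_right_mono powr_mono) (auto simp: field_simps)
      finally show "(\<mu> d j)\<^sup>2 \<le> 1 * sqrt (real s / real j) * (\<mu> d s)\<^sup>2"
        by (simp add: powr_half_sqrt)
    qed simp
    also have "\<dots> \<le> max 2 (K\<^sup>2 * Z) * (real s * (\<mu> d s)\<^sup>2)"
      by (intro mult_right_mono) auto
    finally show "(\<Sum>j=1..s. (\<mu> d j)\<^sup>2) \<le> max 2 (K\<^sup>2 * Z) * (real s * (\<mu> d s)\<^sup>2)" .
  next
    fix d i j :: nat assume "1 \<le> i" "i \<le> j" "j \<le> d"
    then show "\<mu> d j \<le> \<mu> d i"
      unfolding \<mu>_def using a by (intro powr_mono2 divide_left_mono) auto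
  qed (use K \<kappa> \<mu>1 in auto)
  then show ?thesis by (simp only: \<mu>_def)
qed

section \<open>Exponential-type tails\<close>

text \<open>The left side is largest at \<open>z = 2 * p\<close>, with value
  \<open>(2 * p) powr p * exp (- p)\<close>. The inequality \<open>ln u \<le> u - 1\<close> at
  \<open>u = z / (2 * p)\<close> proves this, and the factor \<open>exp (- p)\<close> is
  dropped.\<close>

lemma powr_mult_exp_le:
  fixes z p :: real
  assumes "z > 0" "p > 0"
  shows "z powr p * exp (- z / 2) \<le> (2 * p) powr p"
proof -
  have "ln (z / (2 * p)) \<le> z / (2 * p) - 1"
    using assms by (intro ln_le_minus_one) simp
  then have "p * (ln z - ln (2 * p)) \<le> p * (z / (2 * p) - 1)"
    using assms by (intro mult_left_mono) (simp_all add: ln_div)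
  also have "\<dots> \<le> z / 2" using assms by (simp add: field_simps)
  finally have "p * ln z - z / 2 \<le> p * ln (2 * p)"
    by (simp add: right_diff_distrib)
  then have "exp (p * ln z - z / 2) \<le> exp (p * ln (2 * p))" by (simp only: exp_le_cancel_iff)
  also have "exp (p * ln z - z / 2) = z powr p * exp (- z / 2)"
    using assms by (simp add: powr_def flip: exp_add)
  finally show ?thesis
    using assms by (simp add: powr_def)
qed

lemma class_G_uniform_bound:
  fixes a \<tau> :: real
  assumes \<tau>: "\<tau> > 0" and a: "a > 0"
  shows "\<exists>c C \<gamma>. c > 0 \<and> C > 0 \<and> 0 < \<gamma> \<and> \<gamma> \<le> 1/2 \<and>
        (\<forall>(s::nat) (d::nat) B P \<sigma> \<theta>.
           1 \<le> s \<and> real s < real_of_int \<lfloor>\<gamma> * real d\<rfloor> / 4 \<and>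
           mom_blocks d (nat \<lfloor>\<gamma> * real d\<rfloor>) B \<and>
           class_G a \<tau> P \<and> \<sigma> > 0 \<and> card {i\<in>{..<d}. \<theta> i \<noteq> 0} \<le> s \<longrightarrow>
           expect_Y d P \<sigma> \<theta>
             (\<lambda>Y. \<bar>sigma_hat2 (\<lambda>j. c * ln (exp 1 * real d / real j) powr (1/a)) d (nat \<lfloor>\<gamma> * real d\<rfloor>) B Y - \<sigma>\<^sup>2\<bar>)
           \<le> ennreal (C * \<sigma>\<^sup>2 * max (1 / sqrt (real d)) (real s * (ln (exp 1 * real d / real s) powr (1/a))\<^sup>2 / real d)))"
proof -
  \<comment> \<open>Obtained from \<open>powr_mult_exp_le\<close> with \<open>p = 5 / a\<close> and
    \<open>z = (t / \<tau>) powr a\<close>. The decay exponent 5 is a convenient one above 4, as the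
    fourth moment bound requires.\<close>
  define D where "D = (10 / a) powr (5 / a) * \<tau> powr 5"
  \<comment> \<open>The factor \<open>4 powr (1 / a)\<close> makes
    \<open>(x / \<tau>) powr a \<ge> 4 * l d j\<close> at \<open>x = K * \<mu> d j\<close>, so half
    of the exponent gives at most \<open>(j / d)^2\<close>. This square cancels the weights
    \<open>1 / j^2\<close> in the sum of tail moments.\<close>
  define K where "K = max (max 2 (\<tau> * 4 powr (1 / a))) (10 * D)"
  define E where "E = (max 1 (4 / a)) powr (2 / a)"
  define A where "A = max (2 * E) (10 * D)"
  define \<kappa> where "\<kappa> = 16 + 16 / (1 - 2 powr (4 - 5)) * (2 * D) * 2 powr (4 - 5 :: real)"
  define l where "l = (\<lambda>d j :: nat. ln (exp 1 * real d / real j))"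
  define \<mu> where "\<mu> = (\<lambda>d j. l d j powr (1 / a))"
  have D: "D > 0" using \<tau> a by (simp add: D_def)
  have K: "K \<ge> 2" "\<tau> * 4 powr (1 / a) \<le> K" "10 * D \<le> K" by (simp_all add: K_def)
  have E: "E > 0" by (simp add: E_def)
  have \<kappa>: "\<kappa> \<ge> 0" using D by (simp add: \<kappa>_def powr_minus)
  have expD: "exp (- ((t / \<tau>) powr a) / 2) \<le> D * t powr (- 5)" if t: "t > 0" for t
  proof -
    have "((t / \<tau>) powr a) powr (5 / a) * exp (- ((t / \<tau>) powr a) / 2) \<le> (2 * (5 / a)) powr (5 / a)"
      using t \<tau> a by (intro powr_mult_exp_le) auto
    moreover have "((t / \<tau>) powr a) powr (5 / a) = t powr 5 / \<tau> powr 5"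
      using t \<tau> a by (simp add: powr_powr powr_divide)
    ultimately show ?thesis
      using t \<tau> by (simp add: D_def powr_minus field_simps)
  qed
  \<comment> \<open>The exponent is split into halves: one becomes polynomial decay in
    \<open>t\<close>, the other is frozen at the level \<open>x\<close> and later supplies the
    smallness in \<open>j / d\<close>.\<close>
  have tail: "measure P {y. \<bar>y\<bar> > t} \<le> (2 * D * exp (- ((x / \<tau>) powr a) / 2)) * t powr (- 5)"
    if P: "class_G a \<tau> P" and x: "x \<ge> 2" "t \<ge> x" for P x t
  proof -
    have "(x / \<tau>) powr a \<le> (t / \<tau>) powr a"
      using x \<tau> a by (intro powr_mono2 divide_right_mono) auto
    then have "exp (- ((t / \<tau>) powr a) / 2) \<le> exp (- ((x / \<tau>) powr a) / 2)" by simp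
    then have "exp (- ((t / \<tau>) powr a) / 2) * exp (- ((t / \<tau>) powr a) / 2)
        \<le> exp (- ((x / \<tau>) powr a) / 2) * (D * t powr (- 5))"
      using x expD[of t] by (intro mult_mono) auto
    then have "exp (- ((t / \<tau>) powr a)) \<le> exp (- ((x / \<tau>) powr a) / 2) * (D * t powr (- 5))"
      by (simp flip: exp_add)
    then show ?thesis
      using P x by (auto simp: class_G_def mult_ac intro: order_trans)
  qed
  have l1: "l d j \<ge> 1" if "1 \<le> j" "j \<le> d" for d j
  proof -
    have "exp 1 \<le> exp 1 * real d / real j" using that by (simp add: field_simps)
    then show ?thesis using that by (simp add: l_def ln_ge_iff)
  qed
  have \<mu>1: "\<mu> d j \<ge> 1" if "1 \<le> j" "j \<le> d" for d j
    using l1[OF that] a by (simp add: \<mu>_def ge_one_powr_ge_zero)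
  have \<mu>_sq: "(\<mu> d j)\<^sup>2 = l d j powr (2 / a)" for d j
    by (simp add: \<mu>_def power2_eq_square flip: powr_add)
  have H: "tail_second_moment P (K * \<mu> d j) \<le> 10 * D * (real j / real d)\<^sup>2"
    if P: "class_G a \<tau> P" and j: "1 \<le> j" "j \<le> d" for P d j
  proof -
    define x where "x = K * \<mu> d j"
    define w where "w = exp (- ((x / \<tau>) powr a) / 2)"
    have x: "x \<ge> 2" using mult_mono[OF K(1) \<mu>1[OF j]] K by (simp add: x_def)
    have w0: "w \<ge> 0" by (simp add: w_def)
    have "w \<le> (real j / real d)\<^sup>2"
    proof -
      have "4 = (4 powr (1 / a)) powr a" using a by (simp add: powr_powr)
      also have "\<dots> \<le> (K / \<tau>) powr a"
        using K(2) \<tau> a by (intro powr_mono2) (auto simp: field_simps)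
      finally have "4 * l d j \<le> (K / \<tau>) powr a * l d j"
        using l1[OF j] by (intro mult_right_mono) auto
      also have "\<dots> = (K / \<tau>) powr a * \<mu> d j powr a"
        using l1[OF j] a by (simp add: \<mu>_def powr_powr)
      also have "\<dots> = (x / \<tau>) powr a"
        using K \<tau> \<mu>1[OF j] by (simp add: x_def flip: powr_mult)
      finally have "w \<le> exp (- (2 * l d j))"
        by (simp add: w_def)
      also have "\<dots> = (real j / (exp 1 * real d))\<^sup>2"
        using j by (simp add: l_def exp_minus exp_double inverse_eq_divide power_divide)
      also have "\<dots> \<le> (real j / real d)\<^sup>2"
      proof (intro power_mono divide_left_mono)
        show "real d \<le> exp 1 * real d"
          using mult_right_mono[of 1 "exp 1" "real d"] by simp
      qed (use j in auto)
      finally show ?thesis .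
    qed
    then have Dw: "D * w \<le> D * (real j / real d)\<^sup>2" using D by simp
    have "x powr (2 - 5) \<le> 1"
      using x powr_mono[of "2 - 5" 0 x] by simp
    have "tail_second_moment P x \<le> 4 / (1 - 2 powr (2 - 5)) * (2 * D * w) * x powr (2 - 5)"
      unfolding w_def using P D x by (intro tail_second_moment_le tail) (auto simp: class_G_def)
    also have "\<dots> \<le> 4 / (1 - 2 powr (2 - 5)) * (2 * D * w) * 1"
      using \<open>x powr (2 - 5) \<le> 1\<close> D
      by (intro mult_left_mono mult_nonneg_nonneg) (auto simp: w_def powr_minus)
    \<comment> \<open>\<open>4 / (1 - 1 / 8) * 2 = 64 / 7\<close>, rounded up to 10 in the next
      step.\<close>
    also have "\<dots> = 64 / 7 * (D * w)" by (simp add: powr_minus)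
    also have "\<dots> \<le> 10 * (D * (real j / real d)\<^sup>2)"
      using Dw D w0 by (intro mult_mono) auto
    finally show ?thesis by (simp add: x_def)
  qed
  have "\<exists>c C \<gamma>. c > 0 \<and> C > 0 \<and> 0 < \<gamma> \<and> \<gamma> \<le> 1/2 \<and>
        (\<forall>(s::nat) (d::nat) B P \<sigma> \<theta>.
           1 \<le> s \<and> real s < real_of_int \<lfloor>\<gamma> * real d\<rfloor> / 4 \<and>
           mom_blocks d (nat \<lfloor>\<gamma> * real d\<rfloor>) B \<and>
           class_G a \<tau> P \<and> \<sigma> > 0 \<and> card {i\<in>{..<d}. \<theta> i \<noteq> 0} \<le> s \<longrightarrow>
           expect_Y d P \<sigma> \<theta>
             (\<lambda>Y. \<bar>sigma_hat2 (\<lambda>j. c * \<mu> d j) d (nat \<lfloor>\<gamma> * real d\<rfloor>) B Y - \<sigma>\<^sup>2\<bar>)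
           \<le> ennreal (C * \<sigma>\<^sup>2 * max (1 / sqrt (real d)) (real s * (\<mu> d s)\<^sup>2 / real d)))"
  proof (rule uniform_sigma_hat2_error_le[where \<kappa> = \<kappa> and K = K and A = A])
    fix P assume P: "class_G a \<tau> P"
    then have n: "std_noise P" by (simp add: class_G_def)
    have "measure P {y. \<bar>y\<bar> > t} \<le> (2 * D) * t powr (- 5)" if "t \<ge> 2" for t
    proof -
      have "measure P {y. \<bar>y\<bar> > t} \<le> (2 * D * exp (- ((2 / \<tau>) powr a) / 2)) * t powr (- 5)"
        using tail[OF P, of 2 t] that by simp
      also have "\<dots> \<le> (2 * D * 1) * t powr (- 5)"
        using D by (intro mult_right_mono mult_left_mono) auto
      finally show ?thesis by simp
    qed
    then show "std_noise P \<and> integrable P (\<lambda>x. x ^ 4) \<and> (\<integral>x. x ^ 4 \<partial>P) \<le> \<kappa>"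
      using fourth_moment_le[OF n, of "2 * D" 5] n D by (simp add: \<kappa>_def)
    fix d j :: nat assume j: "1 \<le> j" "j \<le> d"
    have "real d * tail_second_moment P (K * \<mu> d j) \<le> real d * (10 * D * (real j / real d)\<^sup>2)"
      by (intro mult_left_mono H P j) simp
    also have "\<dots> = real j * (10 * D * (real j / real d))"
      using j by (simp add: power2_eq_square)
    also have "\<dots> \<le> real j * (K * \<mu> d j)\<^sup>2"
    proof (rule mult_left_mono)
      have "10 * D * (real j / real d) \<le> 10 * D * 1"
        using j D by (intro mult_left_mono) auto
      also have "\<dots> \<le> K * 1" using K(3) by simp
      also have "\<dots> \<le> K * K" using K(1) by (intro mult_left_mono) auto
      also have "\<dots> \<le> (K * \<mu> d j)\<^sup>2"
        using \<mu>1[OF j] K mult_left_mono[of 1 "(\<mu> d j)\<^sup>2" "K * K"]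
        by (simp add: power_mult_distrib power2_eq_square one_le_mult_iff mult_ge1_I)
      finally show "10 * D * (real j / real d) \<le> (K * \<mu> d j)\<^sup>2" .
    qed simp
    finally show "real d * tail_second_moment P (K * \<mu> d j) \<le> real j * (K * \<mu> d j)\<^sup>2" .
  next
    fix P and d s :: nat assume P: "class_G a \<tau> P" and s: "1 \<le> s" "s \<le> d"
    have "(\<Sum>j=1..d. real d / (real j)\<^sup>2 * tail_second_moment P (K * \<mu> d j))
        \<le> (\<Sum>j=1..d. 10 * D / real d)"
    proof (rule sum_mono)
      fix j assume "j \<in> {1..d}"
      then have j: "1 \<le> j" "j \<le> d" by auto
      have "real d / (real j)\<^sup>2 * tail_second_moment P (K * \<mu> d j)
          \<le> real d / (real j)\<^sup>2 * (10 * D * (real j / real d)\<^sup>2)"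
        by (intro mult_left_mono H P j) simp
      also have "\<dots> = 10 * D / real d"
        using j by (simp add: power2_eq_square)
      finally show "real d / (real j)\<^sup>2 * tail_second_moment P (K * \<mu> d j) \<le> 10 * D / real d" .
    qed
    also have "\<dots> = 10 * D * 1" using s by simp
    also have "\<dots> \<le> A * (real s * (\<mu> d s)\<^sup>2)"
    proof (rule mult_mono)
      show "1 \<le> real s * (\<mu> d s)\<^sup>2"
        using mult_mono[of 1 "real s" 1 "(\<mu> d s)\<^sup>2"] s \<mu>1[OF s] by simp
    qed (use D in \<open>auto simp: A_def\<close>)
    finally show "(\<Sum>j=1..d. real d / (real j)\<^sup>2 * tail_second_moment P (K * \<mu> d j))
        \<le> A * (real s * (\<mu> d s)\<^sup>2)" .
  next
    fix d s :: nat assume s: "1 \<le> s" "s \<le> d"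
    have "(\<Sum>j=1..s. (\<mu> d j)\<^sup>2) \<le> 2 * E * (real s * (\<mu> d s)\<^sup>2)"
    proof (rule sum_squares_le_of_growth)
      fix j assume j: "1 \<le> j" "j \<le> s"
      define y where "y = real s / real j"
      define M where "M = max 1 (4 / a)"
      have y: "y \<ge> 1" using j by (simp add: y_def)
      have ya: "y powr (a / 4) \<ge> 1" using y a by (intro ge_one_powr_ge_zero) auto
      have "l d j = l d s + ln y"
      proof -
        have "exp 1 * real d / real j = (exp 1 * real d / real s) * y"
          using j s by (simp add: y_def)
        moreover have "ln ((exp 1 * real d / real s) * y) = ln (exp 1 * real d / real s) + ln y"
          using j s y by (intro ln_mult_pos) auto
        ultimately show ?thesis by (simp only: l_def)
      qed
      \<comment> \<open>A logarithm is bounded by a power; the exponent \<open>a / 4\<close> is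
        chosen because the later power \<open>2 / a\<close> turns it into a square root. As
        \<open>M \<ge> 1\<close>, a full \<open>- 1\<close> can be kept, which makes the product
        \<open>(M * y powr (a / 4) - 1) * (l d s - 1)\<close> below nonnegative.\<close>
      also have "\<dots> \<le> l d s + (M * y powr (a / 4) - 1)"
      proof -
        have "ln y = 4 / a * ln (y powr (a / 4))"
          using y a by (simp add: ln_powr)
        also have "\<dots> \<le> 4 / a * (y powr (a / 4) - 1)"
          using ya a by (intro mult_left_mono ln_le_minus_one) auto
        also have "\<dots> \<le> M * (y powr (a / 4) - 1)"
          using ya by (intro mult_right_mono) (auto simp: M_def)
        also have "\<dots> \<le> M * y powr (a / 4) - 1"
          by (simp add: right_diff_distrib M_def)
        finally show ?thesis by simp
      qed
      also have "\<dots> \<le> M * y powr (a / 4) * l d s"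
      proof -
        have "M * y powr (a / 4) \<ge> 1"
          using mult_mono[of 1 M 1 "y powr (a / 4)"] ya by (simp add: M_def)
        then have "0 \<le> (M * y powr (a / 4) - 1) * (l d s - 1)"
          using l1[OF s] by (intro mult_nonneg_nonneg) auto
        then show ?thesis by (simp add: algebra_simps)
      qed
      finally have "l d j powr (2 / a) \<le> (M * y powr (a / 4) * l d s) powr (2 / a)"
        using l1[of j d] j s a by (intro powr_mono2) auto
      also have "\<dots> = E * (y powr (a / 4)) powr (2 / a) * l d s powr (2 / a)"
        using l1[OF s] by (simp add: powr_mult E_def M_def)
      also have "(y powr (a / 4)) powr (2 / a) = sqrt y"
        using a y by (simp add: powr_powr powr_half_sqrt)
      finally show "(\<mu> d j)\<^sup>2 \<le> E * sqrt (real s / real j) * (\<mu> d s)\<^sup>2"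
        by (simp add: \<mu>_sq y_def)
    qed (use E in simp)
    also have "\<dots> \<le> A * (real s * (\<mu> d s)\<^sup>2)"
      by (intro mult_right_mono) (auto simp: A_def)
    finally show "(\<Sum>j=1..s. (\<mu> d j)\<^sup>2) \<le> A * (real s * (\<mu> d s)\<^sup>2)" .
  next
    fix d i j :: nat assume ij: "1 \<le> i" "i \<le> j" "j \<le> d"
    have "l d j \<le> l d i"
      unfolding l_def using ij by (intro ln_mono divide_left_mono) auto
    then show "\<mu> d j \<le> \<mu> d i"
      unfolding \<mu>_def using a l1[of j d] ij by (intro powr_mono2) auto
  qed (use K \<kappa> \<mu>1 D in \<open>auto simp: A_def\<close>)
  then show ?thesis by (simp only: \<mu>_def l_def)
qed

theorem theorem7:
  fixes a \<tau> :: real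
  assumes "\<tau> > 0"
  shows
   "(a > 0 \<longrightarrow>
      (\<exists>c C \<gamma>. c > 0 \<and> C > 0 \<and> 0 < \<gamma> \<and> \<gamma> \<le> 1/2 \<and>
        (\<forall>(s::nat) (d::nat) B P \<sigma> \<theta>.
           1 \<le> s \<and> real s < real_of_int \<lfloor>\<gamma> * real d\<rfloor> / 4 \<and>
           mom_blocks d (nat \<lfloor>\<gamma> * real d\<rfloor>) B \<and>
           class_G a \<tau> P \<and> \<sigma> > 0 \<and> card {i\<in>{..<d}. \<theta> i \<noteq> 0} \<le> s \<longrightarrow>
           expect_Y d P \<sigma> \<theta>
             (\<lambda>Y. \<bar>sigma_hat2 (\<lambda>j. c * ln (exp 1 * real d / real j) powr (1/a))
                      d (nat \<lfloor>\<gamma> * real d\<rfloor>) B Y - \<sigma>\<^sup>2\<bar>)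
           \<le> ennreal (C * \<sigma>\<^sup>2 * max (1 / sqrt (real d))
                 (real s / real d * ln (exp 1 * real d / real s) powr (2/a))))))
    \<and>
    (a > 4 \<longrightarrow>
      (\<exists>c C \<gamma>. c > 0 \<and> C > 0 \<and> 0 < \<gamma> \<and> \<gamma> \<le> 1/2 \<and>
        (\<forall>(s::nat) (d::nat) B P \<sigma> \<theta>.
           1 \<le> s \<and> real s < real_of_int \<lfloor>\<gamma> * real d\<rfloor> / 4 \<and>
           mom_blocks d (nat \<lfloor>\<gamma> * real d\<rfloor>) B \<and>
           class_P a \<tau> P \<and> \<sigma> > 0 \<and> card {i\<in>{..<d}. \<theta> i \<noteq> 0} \<le> s \<longrightarrow>
           expect_Y d P \<sigma> \<theta>
             (\<lambda>Y. \<bar>sigma_hat2 (\<lambda>j. c * (real d / real j) powr (1/a))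
                      d (nat \<lfloor>\<gamma> * real d\<rfloor>) B Y - \<sigma>\<^sup>2\<bar>)
           \<le> ennreal (C * \<sigma>\<^sup>2 * max (1 / sqrt (real d))
                 ((real s / real d) powr (1 - 2/a))))))"
proof -
  have rate_G: "real s * (ln (exp 1 * real d / real s) powr (1/a))\<^sup>2 / real d
      = real s / real d * ln (exp 1 * real d / real s) powr (2/a)" for s d :: nat
    by (simp add: power2_eq_square flip: powr_add)
  have rate_P: "real s * ((real d / real s) powr (1/a))\<^sup>2 / real d = (real s / real d) powr (1 - 2/a)"
    for s d :: nat
  \<comment> \<open>The identity is used for unconditional rewriting, so degenerate arguments count
    too: for \<open>s = 0\<close> or \<open>d = 0\<close> both sides are 0, by division by zero and
    \<open>0 powr _ = 0\<close>.\<close>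
  proof (cases "s = 0 \<or> d = 0")
    case False
    have "((real d / real s) powr (1/a))\<^sup>2 = (real d / real s) powr (2/a)"
      by (simp add: power2_eq_square flip: powr_add)
    also have "\<dots> = inverse ((real s / real d) powr (2/a))"
      by (simp add: powr_divide)
    finally show ?thesis
      using False by (simp add: powr_diff divide_inverse)
  qed auto
  show ?thesis
    using class_G_uniform_bound[OF assms, of a, unfolded rate_G]
      class_P_uniform_bound[OF assms, of a, unfolded rate_P] by blast
qed

end
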